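(* Assume the Continuum Hypothesis. Then $FCA^\Delta$ holds: for every good type $\tau$ there exists a fully $\Delta$-capturing construction scheme of type $\tau$ over $\omega_1$.
   Context: A type is a sequence $\tau=\langle m_k,n_{k+1},r_{k+1}\rangle_{k\in\omega}$ of natural numbers with $m_0=1$ and, for all $k$, $n_{k+1}\geq2$, $m_k>r_{k+1}$, $m_{k+1}=r_{k+1}+(m_k-r_{k+1})n_{k+1}$. It is good if for every $r\in\omega$ there are infinitely many $k\geq1$ with $r_k=r$. For sets of ordinals, $A<B$ means every element of $A$ is below every element of $B$; for a finite set $D$ of ordinals, $D(a)$ is its $a$-th element in increasing order. A construction scheme of type $\tau$ over a set of ordinals $Y$ is a family $\mathcal{F}$ of nonempty finite subsets of $Y$, cofinal under $\subseteq$ among finite subsets of $Y$, each member of size $m_k$ for some $k$, such that with $\mathcal{F}_k=\{F\in\mathcal{F}:|F|=m_k\}$: (i) for $E,F\in\mathcal{F}_k$, $E\cap F$ is an initial segment of both $E$ and $F$; (ii) every $F\in\mathcal{F}_{k+1}$ is $F_0\cup\dots\cup F_{n_{k+1}-1}$ with $F_i\in\mathcal{F}_k$ forming a $\Delta$-system with root $R(F)$, $|R(F)|=r_{k+1}$, and $R(F)<F_0\setminus R(F)<\dots<F_{n_{k+1}-1}\setminus R(F)$ (this decomposition is unique). Associated functions: $\rho(\alpha,\beta)=\min\{k:\exists F\in\mathcal{F}_k\ \{\alpha,\beta\}\subseteq F\}$; $(\alpha)_k=\{\xi\leq\alpha:\rho(\xi,\alpha)\leq k\}$, $(\alpha)^-_k=(\alpha)_k\setminus\{\alpha\}$,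 $\lVert\alpha\rVert_k=|(\alpha)^-_k|$; $\Delta(\alpha,\beta)=\min\{k:\lVert\alpha\rVert_k\neq\lVert\beta\rVert_k\}$ ($=\omega$ if none); for $k\geq1$ (with $m_k\leq|Y|$), $\Xi_\alpha(k)=-1$ if $\alpha\in R(F)$ and $\Xi_\alpha(k)=i$ if $\alpha\in F_i\setminus R(F)$, for any $F\in\mathcal{F}_k$ containing $\alpha$ (independent of the choice of $F$); $\Xi_\alpha(0)=0$. A root-tail-tail $\Delta$-system is a sequence $\langle D_i\rangle_{i<n}$, $n\geq2$, of finite sets of ordinals of common size $m$ with pairwise intersections equal to $R$, $R<D_i\setminus R$, and $D_0\setminus R<D_1\setminus R<\dots<D_{n-1}\setminus R$; let $r=|R|$. For $\nu\in\{\rho,\Delta\}$ and $l\geq1$, it is $\nu$-captured at level $l$ if $n\leq n_l$ and (I) for all $i<n$, $a<m$: $\Xi_{D_i(a)}(l)=-1$ if $a<r$ and $=i$ if $a\geq r$; (II) $\nu(D_i(a),D_j(a))=l$ for all $i<j<n$ and $r\leq a<m$. It is fully $\nu$-captured at level $l$ if moreover $n=n_l$. A scheme $\mathcal{F}$ over $\omega_1$ is fully $\nu$-capturing if for every uncountable family $\mathcal{S}$ of nonempty finite subsets of $\omega_1$ there are infinitely many $l$ for which some $n_l$ distinct members of $\mathcal{S}$, suitably enumerated, form a root-tail-tail $\Delta$-system fully $\nu$-captured at level $l$. *)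

theory Defs
  imports Main "HOL-Library.Extended_Nat" "HOL-Library.Countable_Set"
begin

text \<open>W is a well-order (of ordinals) isomorphic to omega_1: uncountable, and
every proper initial segment is countable. The ordinals below omega_1 are the
elements of Field W, ordered by W.\<close>

definition omega1_order :: "'a rel \<Rightarrow> bool" where
  "omega1_order W \<longleftrightarrow> Well_order W \<and> \<not> countable (Field W) \<and>
     (\<forall>x\<in>Field W. countable {y. (y, x) \<in> W})"

definition lessW :: "'a rel \<Rightarrow> 'a \<Rightarrow> 'a \<Rightarrow> bool" where
  "lessW W x y \<longleftrightarrow> (x, y) \<in> W \<and> x \<noteq> y"

definition set_less :: "'a rel \<Rightarrow> 'a set \<Rightarrow> 'a set \<Rightarrow> bool" where
  "set_less W A B \<longleftrightarrow> (\<forall>x\<in>A. \<forall>y\<in>B. lessW W x y)"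

definition enum :: "'a rel \<Rightarrow> 'a set \<Rightarrow> nat \<Rightarrow> 'a" where
  "enum W D a = (THE x. x \<in> D \<and> card {y\<in>D. lessW W y x} = a)"

definition initial_segment :: "'a rel \<Rightarrow> 'a set \<Rightarrow> 'a set \<Rightarrow> bool" where
  "initial_segment W I E \<longleftrightarrow> I \<subseteq> E \<and> (\<forall>x\<in>I. \<forall>y\<in>E. lessW W y x \<longrightarrow> y \<in> I)"

text \<open>A type \<langle>m_k, n_{k+1}, r_{k+1}\<rangle> is given by three sequences m n r; the
values n 0 and r 0 are irrelevant.\<close>
definition is_type :: "(nat \<Rightarrow> nat) \<Rightarrow> (nat \<Rightarrow> nat) \<Rightarrow> (nat \<Rightarrow> nat) \<Rightarrow> bool" where
  "is_type m n r \<longleftrightarrow> m 0 = 1 \<and>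
     (\<forall>k. n (Suc k) \<ge> 2 \<and> m k > r (Suc k) \<and>
          m (Suc k) = r (Suc k) + (m k - r (Suc k)) * n (Suc k))"

definition good_type :: "(nat \<Rightarrow> nat) \<Rightarrow> (nat \<Rightarrow> nat) \<Rightarrow> (nat \<Rightarrow> nat) \<Rightarrow> bool" where
  "good_type m n r \<longleftrightarrow> is_type m n r \<and> (\<forall>x. infinite {k. k \<ge> 1 \<and> r k = x})"

definition level :: "(nat \<Rightarrow> nat) \<Rightarrow> 'a set set \<Rightarrow> nat \<Rightarrow> 'a set set" where
  "level m \<F> k = {F \<in> \<F>. card F = m k}"

definition decomposition ::
  "'a rel \<Rightarrow> (nat \<Rightarrow> nat) \<Rightarrow> (nat \<Rightarrow> nat) \<Rightarrow> (nat \<Rightarrow> nat) \<Rightarrow> 'a set set \<Rightarrow> nat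
     \<Rightarrow> 'a set \<Rightarrow> (nat \<Rightarrow> 'a set) \<Rightarrow> 'a set \<Rightarrow> bool" where
  "decomposition W m n r \<F> k F Fs R \<longleftrightarrow>
     (\<forall>i<n (Suc k). Fs i \<in> level m \<F> k) \<and>
     F = (\<Union>i<n (Suc k). Fs i) \<and>
     (\<forall>i<n (Suc k). \<forall>j<n (Suc k). i \<noteq> j \<longrightarrow> Fs i \<inter> Fs j = R) \<and>
     card R = r (Suc k) \<and>
     set_less W R (Fs 0 - R) \<and>
     (\<forall>i. Suc i < n (Suc k) \<longrightarrow> set_less W (Fs i - R) (Fs (Suc i) - R))"

definition construction_scheme ::
  "'a rel \<Rightarrow> 'a set \<Rightarrow> (nat \<Rightarrow> nat) \<Rightarrow> (nat \<Rightarrow> nat) \<Rightarrow> (nat \<Rightarrow> nat) \<Rightarrow> 'a set set \<Rightarrow> bool" where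
  "construction_scheme W Y m n r \<F> \<longleftrightarrow>
     (\<forall>F\<in>\<F>. finite F \<and> F \<noteq> {} \<and> F \<subseteq> Y \<and> (\<exists>k. card F = m k)) \<and>
     (\<forall>A. finite A \<and> A \<subseteq> Y \<longrightarrow> (\<exists>F\<in>\<F>. A \<subseteq> F)) \<and>
     (\<forall>k. \<forall>E\<in>level m \<F> k. \<forall>F\<in>level m \<F> k.
         initial_segment W (E \<inter> F) E \<and> initial_segment W (E \<inter> F) F) \<and>
     (\<forall>k. \<forall>F\<in>level m \<F> (Suc k). \<exists>Fs R. decomposition W m n r \<F> k F Fs R)"

definition rho :: "(nat \<Rightarrow> nat) \<Rightarrow> 'a set set \<Rightarrow> 'a \<Rightarrow> 'a \<Rightarrow> nat" where
  "rho m \<F> \<alpha> \<beta> = (LEAST k. \<exists>F\<in>level m \<F> k. {\<alpha>, \<beta>} \<subseteq> F)"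

definition closure_k :: "'a rel \<Rightarrow> 'a set \<Rightarrow> (nat \<Rightarrow> nat) \<Rightarrow> 'a set set \<Rightarrow> 'a \<Rightarrow> nat \<Rightarrow> 'a set" where
  "closure_k W Y m \<F> \<alpha> k = {\<xi> \<in> Y. (\<xi>, \<alpha>) \<in> W \<and> rho m \<F> \<xi> \<alpha> \<le> k}"

definition norm_k :: "'a rel \<Rightarrow> 'a set \<Rightarrow> (nat \<Rightarrow> nat) \<Rightarrow> 'a set set \<Rightarrow> 'a \<Rightarrow> nat \<Rightarrow> nat" where
  "norm_k W Y m \<F> \<alpha> k = card (closure_k W Y m \<F> \<alpha> k - {\<alpha>})"

definition Delta :: "'a rel \<Rightarrow> 'a set \<Rightarrow> (nat \<Rightarrow> nat) \<Rightarrow> 'a set set \<Rightarrow> 'a \<Rightarrow> 'a \<Rightarrow> enat" where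
  "Delta W Y m \<F> \<alpha> \<beta> =
     (if \<exists>k. norm_k W Y m \<F> \<alpha> k \<noteq> norm_k W Y m \<F> \<beta> k
      then enat (LEAST k. norm_k W Y m \<F> \<alpha> k \<noteq> norm_k W Y m \<F> \<beta> k)
      else \<infinity>)"

text \<open>\<Xi>_\<alpha>(k): for k \<ge> 1, the position of \<alpha> in the canonical decomposition of any
F in level k containing \<alpha> (-1 for the root); \<Xi>_\<alpha>(0) = 0.\<close>
definition Xi :: "'a rel \<Rightarrow> (nat \<Rightarrow> nat) \<Rightarrow> (nat \<Rightarrow> nat) \<Rightarrow> (nat \<Rightarrow> nat) \<Rightarrow> 'a set set
                   \<Rightarrow> 'a \<Rightarrow> nat \<Rightarrow> int" where
  "Xi W m n r \<F> \<alpha> k =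
     (if k = 0 then 0 else
      (THE v. \<exists>F\<in>level m \<F> k. \<alpha> \<in> F \<and>
         (\<exists>Fs R. decomposition W m n r \<F> (k - 1) F Fs R \<and>
            ((\<alpha> \<in> R \<and> v = -1) \<or> (\<exists>i<n k. \<alpha> \<in> Fs i - R \<and> v = int i)))))"

definition rtt_system :: "'a rel \<Rightarrow> (nat \<Rightarrow> 'a set) \<Rightarrow> nat \<Rightarrow> nat \<Rightarrow> 'a set \<Rightarrow> bool" where
  "rtt_system W D N sz R \<longleftrightarrow> N \<ge> 2 \<and>
     (\<forall>i<N. finite (D i) \<and> card (D i) = sz \<and> set_less W R (D i - R)) \<and>
     (\<forall>i<N. \<forall>j<N. i \<noteq> j \<longrightarrow> D i \<inter> D j = R) \<and>
     (\<forall>i. Suc i < N \<longrightarrow> set_less W (D i - R) (D (Suc i) - R))"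

definition captured ::
  "'a rel \<Rightarrow> (nat \<Rightarrow> nat) \<Rightarrow> (nat \<Rightarrow> nat) \<Rightarrow> (nat \<Rightarrow> nat) \<Rightarrow> 'a set set
     \<Rightarrow> ('a \<Rightarrow> 'a \<Rightarrow> enat) \<Rightarrow> (nat \<Rightarrow> 'a set) \<Rightarrow> nat \<Rightarrow> nat \<Rightarrow> bool" where
  "captured W m n r \<F> \<nu> D N l \<longleftrightarrow> l \<ge> 1 \<and>
     (\<exists>sz R. rtt_system W D N sz R \<and> N \<le> n l \<and>
        (\<forall>i<N. \<forall>a<sz. Xi W m n r \<F> (enum W (D i) a) l =
              (if a < card R then -1 else int i)) \<and>
        (\<forall>i j a. i < j \<and> j < N \<and> card R \<le> a \<and> a < sz \<longrightarrow>
              \<nu> (enum W (D i) a) (enum W (D j) a) = enat l))"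

definition fully_captured ::
  "'a rel \<Rightarrow> (nat \<Rightarrow> nat) \<Rightarrow> (nat \<Rightarrow> nat) \<Rightarrow> (nat \<Rightarrow> nat) \<Rightarrow> 'a set set
     \<Rightarrow> ('a \<Rightarrow> 'a \<Rightarrow> enat) \<Rightarrow> (nat \<Rightarrow> 'a set) \<Rightarrow> nat \<Rightarrow> bool" where
  "fully_captured W m n r \<F> \<nu> D l \<longleftrightarrow> captured W m n r \<F> \<nu> D (n l) l"

definition fully_Delta_capturing ::
  "'a rel \<Rightarrow> (nat \<Rightarrow> nat) \<Rightarrow> (nat \<Rightarrow> nat) \<Rightarrow> (nat \<Rightarrow> nat) \<Rightarrow> 'a set set \<Rightarrow> bool" where
  "fully_Delta_capturing W m n r \<F> \<longleftrightarrow>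
     (\<forall>\<S>. \<S> \<subseteq> {A. finite A \<and> A \<noteq> {} \<and> A \<subseteq> Field W} \<and> \<not> countable \<S> \<longrightarrow>
        infinite {l. \<exists>D. (\<forall>i<n l. D i \<in> \<S>) \<and> inj_on D {..<n l} \<and>
                     fully_captured W m n r \<F> (Delta W (Field W) m \<F>) D l})"

definition CH :: bool where
  "CH \<longleftrightarrow> (\<forall>A::real set. countable A \<or> (\<exists>f. bij_betw f A (UNIV :: real set)))"

end

theory Submission
  imports Defs "HOL-Analysis.Abstract_Topology_2"
begin

text \<open>
  Writing \<open>f \<alpha> k\<close> for the position of \<open>\<alpha>\<close> in any level-\<open>k\<close> member of a construction scheme that
  contains it, each ordinal becomes a branch of a finitely branching tree \<open>T\<close> determined by the type,
  and the whole scheme can be recovered from these branches: \<open>\<xi> \<le> \<alpha>\<close> lies in the level-\<open>k\<close> closure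
  of \<open>\<alpha>\<close> iff from level \<open>k\<close> on \<open>\<xi>\<close> either sits in the root or moves together with \<open>\<alpha>\<close>. So the task is
  to find an \<open>\<omega>\<^sub>1\<close>-chain of branches in the resulting order. Successors are obtained by adding 1 to
  every position; at limits the new branch is built by a sequence of finite approximations.

  The values \<open>\<Delta>\<close> and \<open>\<Xi>\<close> depend on the branches only, and a subset of \<open>T\<close> is coded by a subset of
  \<open>nat \<times> nat\<close>, of which CH gives an enumeration in type \<open>\<omega>\<^sub>1\<close>. As in the construction of a Luzin set,
  the branch at a limit \<open>\<alpha>\<close> is made generic for the subsets \<open>E e\<close> of \<open>T\<close> enumerated at stages \<open>e\<close>
  below \<open>\<alpha>\<close>: if it stays inside \<open>E e\<close>, then some finite approximation forces this. For an uncountable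
  family of finite sets, let \<open>E e\<close> consist of the positions that are taken by the maxima of uncountably
  many members. A late member stays inside \<open>E e\<close>, and the forcing approximation, pulled back along the
  finitely many steps from its maximum to the first point of its tail, yields a level at which all
  \<open>n l\<close> successors of one node of \<open>T\<close> are in \<open>E e\<close>. These are realized by a captured Delta-system.
\<close>

section \<open>Branches of positions\<close>

locale scheme_type =
  fixes m n r :: "nat \<Rightarrow> nat"
  assumes good: "good_type m n r"
begin

section \<open>Arithmetic of the block sizes\<close>

lemma n_ge2: "n (Suc k) \<ge> 2"
  and r_less_m: "r (Suc k) < m k"
  and m_Suc: "m (Suc k) = r (Suc k) + (m k - r (Suc k)) * n (Suc k)"
  using good by (auto simp: good_type_def is_type_def)

lemma r_recurs: "\<exists>l\<ge>J. r (Suc l) = c"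
proof -
  have "infinite {k. k \<ge> 1 \<and> r k = c}"
    using good by (auto simp: good_type_def)
  then obtain k where "k > Suc J" "k \<ge> 1" "r k = c"
    by (auto simp: infinite_nat_iff_unbounded)
  then show ?thesis
    by (intro exI[of _ "k - 1"]) auto
qed

lemma block_add_le: "i < n (Suc k) \<Longrightarrow> m k + i * (m k - r (Suc k)) \<le> m (Suc k)"
proof -
  assume "i < n (Suc k)"
  then have "Suc i * (m k - r (Suc k)) \<le> n (Suc k) * (m k - r (Suc k))"
    by (intro mult_le_mono1) auto
  then have "(m k - r (Suc k)) + i * (m k - r (Suc k)) \<le> (m k - r (Suc k)) * n (Suc k)"
    by (simp only: mult_Suc mult.commute)
  then show ?thesis
    using m_Suc[of k] r_less_m[of k] by linarith
qed

lemma m_less_Suc: "m k < m (Suc k)"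
  using block_add_le[of 1 k] n_ge2[of k] r_less_m[of k] by simp

lemma strict_mono_m: "strict_mono m"
  by (simp add: strict_mono_Suc_iff m_less_Suc)

lemma m_eq_iff: "m k = m l \<longleftrightarrow> k = l"
  using strict_mono_m strict_mono_eq by blast

lemma m_pos: "0 < m k"
  using r_less_m[of k] by simp

text \<open>Passing from level \<open>k\<close> to \<open>Suc k\<close>, an element at position \<open>p\<close> of a level-\<open>k\<close> set
  keeps its position if it lies in the root and otherwise moves by one of the \<open>n (Suc k)\<close> blocks.\<close>

definition lstep :: "nat \<Rightarrow> nat \<Rightarrow> nat \<Rightarrow> bool" where
  "lstep k p q \<longleftrightarrow>
     (if p < r (Suc k) then q = p else \<exists>i<n (Suc k). q = p + i * (m k - r (Suc k)))"

definition branch :: "(nat \<Rightarrow> nat) \<Rightarrow> bool" where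
  "branch x \<longleftrightarrow> (\<forall>k. x k < m k \<and> lstep k (x k) (x (Suc k)))"

lemma lstep_le: "lstep k p q \<Longrightarrow> p \<le> q"
  by (auto simp: lstep_def split: if_splits)

lemma lstep_refl: "lstep k p p"
  using n_ge2[of k] by (auto simp: lstep_def intro!: exI[of _ 0])

lemma lstep_less: "lstep k p q \<Longrightarrow> p < m k \<Longrightarrow> q < m (Suc k)"
proof -
  assume *: "lstep k p q" "p < m k"
  show ?thesis
  proof (cases "p < r (Suc k)")
    case True
    then show ?thesis using * m_less_Suc[of k] by (auto simp: lstep_def)
  next
    case False
    then obtain i where "i < n (Suc k)" "q = p + i * (m k - r (Suc k))"
      using * by (auto simp: lstep_def)
    then show ?thesis using * block_add_le[of i k] by linarith
  qed
qed

lemma lstep_root: "lstep k p q \<Longrightarrow> q < r (Suc k) \<or> p < r (Suc k) \<Longrightarrow> q = p"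
  by (auto simp: lstep_def split: if_splits)

text \<open>A nontrivial move adds at least \<open>m k - r (Suc k)\<close> to a position that is at
  least \<open>r (Suc k)\<close>, so it lands at or beyond \<open>m k\<close>.\<close>

lemma lstep_stay: "lstep k p q \<Longrightarrow> q < m k \<Longrightarrow> q = p"
proof -
  assume *: "lstep k p q" "q < m k"
  show ?thesis
  proof (cases "p < r (Suc k)")
    case False
    then obtain i where i: "q = p + i * (m k - r (Suc k))"
      using * by (auto simp: lstep_def)
    show ?thesis
    proof (cases i)
      case (Suc j)
      then have "q \<ge> p + (m k - r (Suc k))" using i by simp
      then show ?thesis using False * by linarith
    qed (use i in simp)
  qed (use * in \<open>auto simp: lstep_def\<close>)
qed

text \<open>Outside the root the same block index serves for the next position; if \<open>p\<close>
  is the last root position, block 0 serves for \<open>Suc p\<close>. This closure under adding 1 is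
  what produces successor ordinals.\<close>

lemma lstep_Suc: "lstep k p q \<Longrightarrow> lstep k (Suc p) (Suc q)"
  using n_ge2[of k] by (auto simp: lstep_def split: if_splits intro!: exI[of _ 0])

text \<open>Uniqueness of quotient and remainder: after subtracting \<open>r (Suc k)\<close>, the
  old position is the remainder modulo \<open>m k - r (Suc k)\<close> and the block index is the
  quotient.\<close>

lemma block_unique:
  assumes "p + i * (m k - r (Suc k)) = p' + i' * (m k - r (Suc k))"
    and "r (Suc k) \<le> p" "p < m k" "r (Suc k) \<le> p'" "p' < m k"
  shows "p = p'" "i = i'"
proof -
  define M where "M = m k - r (Suc k)"
  have "(p - r (Suc k)) + i * M = (p' - r (Suc k)) + i' * M"
    using assms by (simp add: M_def)
  moreover have "p - r (Suc k) < M" "p' - r (Suc k) < M"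
    using assms by (auto simp: M_def)
  ultimately have "p - r (Suc k) = p' - r (Suc k) \<and> i = i'"
    by (metis add.commute div_less div_mult_self1 gr_implies_not0 mod_less mod_mult_self1 add_0)
  then show "p = p'" "i = i'"
    using assms by auto
qed

lemma lstep_inj:
  assumes "lstep k p q" "lstep k p' q" "p < m k" "p' < m k"
  shows "p = p'"
proof (cases "q < r (Suc k)")
  case True
  then show ?thesis using assms lstep_root by metis
next
  case False
  then have "\<not> p < r (Suc k)" "\<not> p' < r (Suc k)"
    using assms lstep_root by metis+
  then show ?thesis
    using assms block_unique(1)[of p _ k p'] by (auto simp: lstep_def)
qed

text \<open>A nonroot position comes from reducing its distance to \<open>r (Suc k)\<close> modulo
  the block length.\<close>

lemma lstep_down:
  assumes "q < m (Suc k)"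
  shows "\<exists>p<m k. lstep k p q"
proof (cases "q < r (Suc k)")
  case True
  then show ?thesis
    using r_less_m[of k] by (intro exI[of _ q]) (auto simp: lstep_def)
next
  case False
  define M where "M = m k - r (Suc k)"
  define p where "p = r (Suc k) + (q - r (Suc k)) mod M"
  have M: "M > 0" using r_less_m[of k] by (simp add: M_def)
  have "q - r (Suc k) < n (Suc k) * M"
    using assms False m_Suc[of k] by (simp add: M_def mult.commute)
  then have "(q - r (Suc k)) div M < n (Suc k)"
    using M by (simp add: less_mult_imp_div_less)
  moreover have "q = p + (q - r (Suc k)) div M * M"
    using False by (simp add: p_def)
  moreover have "p < m k"
    using M mod_less_divisor[of M "q - r (Suc k)"] unfolding p_def M_def by linarith
  ultimately show ?thesis
    by (intro exI[of _ p]) (auto simp: lstep_def M_def p_def)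
qed

section \<open>Branches and the closure relation between them\<close>

lemma branch_less: "branch x \<Longrightarrow> x k < m k"
  and branch_lstep: "branch x \<Longrightarrow> lstep k (x k) (x (Suc k))"
  by (auto simp: branch_def)

lemma branch_mono: "branch x \<Longrightarrow> j \<le> k \<Longrightarrow> x j \<le> x k"
  by (rule lift_Suc_mono_le) (use branch_lstep lstep_le in blast)+

lemma branch_eq_below:
  assumes "branch x" "branch y" "x k = y k" "j \<le> k"
  shows "x j = y j"
  using assms(4,3)
proof (induction rule: inc_induct)
  case (step i)
  then show ?case
    using assms(1,2) lstep_inj unfolding branch_def by metis
qed

text \<open>By \<open>lstep_down\<close> the finitely many missing values can be filled in
  downwards. Later constructions therefore prescribe a branch only from some level on.\<close>

lemma tail_extends_to_branch:
  assumes "\<And>k. k \<ge> K \<Longrightarrow> x k < m k \<and> lstep k (x k) (x (Suc k))"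
  obtains y where "branch y" "\<And>k. k \<ge> K \<Longrightarrow> y k = x k"
proof -
  have "\<exists>y. branch y \<and> (\<forall>k\<ge>K. y k = x k)"
    using assms
  proof (induction K arbitrary: x)
    case 0
    then show ?case by (auto simp: branch_def)
  next
    case (Suc K)
    obtain p where p: "p < m K" "lstep K p (x (Suc K))"
      using lstep_down Suc.prems[of "Suc K"] by auto
    have "\<exists>y. branch y \<and> (\<forall>k\<ge>K. y k = (x(K := p)) k)"
    proof (rule Suc.IH)
      fix k assume "K \<le> k"
      then show "(x(K := p)) k < m k \<and> lstep k ((x(K := p)) k) ((x(K := p)) (Suc k))"
        using p Suc.prems[of k] by (cases "k = K") auto
    qed
    then show ?case
      by (metis Suc_leD fun_upd_other not_less_eq_eq order_refl)
  qed
  then show ?thesis using that by blast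
qed

text \<open>Membership in a level-\<open>k\<close> closure expressed by branches: from level
  \<open>k\<close> on, \<open>x\<close> is in the root or in the same block as \<open>y\<close>. The
  equation compares the two increments without subtracting natural numbers.\<close>

definition below :: "nat \<Rightarrow> (nat \<Rightarrow> nat) \<Rightarrow> (nat \<Rightarrow> nat) \<Rightarrow> bool" where
  "below k x y \<longleftrightarrow>
     (\<forall>j\<ge>k. x j \<le> y j \<and> (x j < r (Suc j) \<or> x (Suc j) + y j = y (Suc j) + x j))"

lemma below_le: "below k x y \<Longrightarrow> k \<le> j \<Longrightarrow> x j \<le> y j"
  by (auto simp: below_def)

lemma below_shift: "below k x y \<Longrightarrow> k \<le> j \<Longrightarrow> r (Suc j) \<le> x j \<Longrightarrow> x (Suc j) + y j = y (Suc j) + x j"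
  by (auto simp: below_def leD)

lemma below_refl [simp]: "below k x x"
  by (simp add: below_def)

lemma below_mono: "below k x y \<Longrightarrow> k \<le> k' \<Longrightarrow> below k' x y"
  by (auto simp: below_def)

text \<open>If \<open>x\<close> is outside the root then so is \<open>y\<close>, whose position is
  at least as large; hence both move by the increment of \<open>z\<close>.\<close>

lemma below_trans: "below k x y \<Longrightarrow> below k y z \<Longrightarrow> below k x z"
proof -
  assume *: "below k x y" "below k y z"
  show ?thesis
    unfolding below_def
  proof (intro allI impI conjI)
    fix j assume j: "k \<le> j"
    show "x j \<le> z j" using below_le[OF *(1) j] below_le[OF *(2) j] by simp
    show "x j < r (Suc j) \<or> x (Suc j) + z j = z (Suc j) + x j"
      using below_le[OF *(1) j] below_shift[OF *(1) j] below_shift[OF *(2) j] by linarith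
  qed
qed

text \<open>Two branches below a common \<open>z\<close> keep their order: outside the root both
  move with \<open>z\<close>, while a smaller position in the root stays and the other cannot
  decrease. This makes intersections of closures initial segments.\<close>

lemma below_cut:
  assumes "branch x" "branch y" "below k x z" "below k y z" "x k \<le> y k"
  shows "below k x y"
proof -
  have le: "x j \<le> y j" if "k \<le> j" for j
    using that
  proof (induction rule: dec_induct)
    case (step j)
    show ?case
    proof (cases "x j < r (Suc j)")
      case True
      then have "x (Suc j) = x j" using assms(1) lstep_root branch_lstep by blast
      then show ?thesis using step branch_mono[OF assms(2), of j "Suc j"] by simp
    next
      case False
      then show ?thesis
        using step below_shift[OF assms(3), of j] below_shift[OF assms(4), of j] by linarith
    qed
  qed (use assms in auto)
  show ?thesis
    unfolding below_def
  proof (intro allI impI conjI)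
    fix j assume j: "k \<le> j"
    show "x j \<le> y j" by (rule le[OF j])
    show "x j < r (Suc j) \<or> x (Suc j) + y j = y (Suc j) + x j"
      using below_shift[OF assms(3) j] below_shift[OF assms(4) j] le[OF j] by linarith
  qed
qed

lemma below_less:
  assumes "branch x" "branch y" "below k x y" "x k < y k" "k \<le> j"
  shows "x j < y j"
  using assms(5)
proof (induction rule: dec_induct)
  case (step j)
  show ?case
  proof (cases "x j < r (Suc j)")
    case True
    then have "x (Suc j) = x j" using assms(1) lstep_root branch_lstep by blast
    then show ?thesis using step branch_mono[OF assms(2), of j "Suc j"] by simp
  next
    case False
    then show ?thesis using step below_shift[OF assms(3), of j] by linarith
  qed
qed (use assms in auto)

text \<open>Agreement under level \<open>k\<close> follows from injectivity of the steps, agreement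
  above it from \<open>below_cut\<close> in both directions.\<close>

lemma below_antisym_at:
  assumes "branch x" "branch y" "below k x z" "below k y z" "x k = y k"
  shows "x = y"
proof
  fix j
  have "below k x y" "below k y x"
    using assms below_cut by auto
  then show "x j = y j"
    using branch_eq_below[OF assms(1,2,5), of j] below_le[of k x y j] below_le[of k y x j]
    by (cases "j \<le> k") auto
qed

lemma below_SucD:
  assumes "below (Suc k) x y" "x k \<le> y k" "x k < r (Suc k) \<or> x (Suc k) + y k = y (Suc k) + x k"
  shows "below k x y"
  unfolding below_def
proof (intro allI impI)
  fix j assume "k \<le> j"
  then show "x j \<le> y j \<and> (x j < r (Suc j) \<or> x (Suc j) + y j = y (Suc j) + x j)"
    using assms by (cases "j = k") (auto simp: below_def)
qed

text \<open>At each level \<open>x\<close> either stays or moves by the increment of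
  \<open>y\<close>, so its path can be computed from its value at \<open>k\<close> and the path of
  \<open>y\<close>.\<close>

lemma below_trace_unique:
  assumes "branch x" "branch x'" "below k x y" "below k x' y'" "x k = x' k"
    and "\<And>j. k \<le> j \<Longrightarrow> j \<le> l \<Longrightarrow> y j = y' j" and "k \<le> j" "j \<le> l"
  shows "x j = x' j"
  using assms(7,8)
proof (induction rule: dec_induct)
  case (step j)
  then have eq: "x j = x' j" "y j = y' j" "y (Suc j) = y' (Suc j)"
    using assms(6)[of j] assms(6)[of "Suc j"] by auto
  show ?case
  proof (cases "x j < r (Suc j)")
    case True
    then show ?thesis
      using eq assms(1,2) lstep_root branch_lstep by metis
  next
    case False
    then show ?thesis
      using step eq below_shift[OF assms(3), of j] below_shift[OF assms(4), of j] by linarith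
  qed
qed (use assms in auto)

lemma branch_Suc_tail:
  assumes "branch x" "Suc (x K) < m K" "K \<le> k"
  shows "Suc (x k) < m k"
  using assms(3)
proof (induction rule: dec_induct)
  case (step k)
  then show ?case
    using lstep_less[OF lstep_Suc[OF branch_lstep[OF assms(1)]]] by blast
qed (use assms in auto)

text \<open>A position \<open>p\<close> under \<open>v K\<close> is followed into the root or into
  the block of \<open>v\<close> at level \<open>Suc K\<close>; whatever occupies the new position
  there had position \<open>p\<close> before, as steps are injective. So filling has to be checked
  at high levels only.\<close>

lemma positions_filled_down:
  assumes "branch v" and br: "\<And>b. b \<in> B \<Longrightarrow> branch (f b)"
    and filled: "\<And>k p. k \<ge> K \<Longrightarrow> p < v k \<Longrightarrow> \<exists>b\<in>B. f b k = p \<and> below k (f b) v"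
    and "p < v k"
  shows "\<exists>b\<in>B. f b k = p \<and> below k (f b) v"
  using filled assms(4)
proof (induction K arbitrary: k p)
  case (Suc K)
  have "\<exists>b\<in>B. f b k = p \<and> below k (f b) v" if "k \<ge> K" "p < v k" for k p
  proof (cases "k = K")
    case False
    then show ?thesis using Suc.prems(1) that by auto
  next
    case True
    have st: "lstep K (v K) (v (Suc K))" "v K < m K"
      using assms(1) by (auto simp: branch_def)
    obtain q where q: "lstep K p q" "q < v (Suc K)" "p < r (Suc K) \<or> q + v K = v (Suc K) + p"
    proof (cases "p < r (Suc K)")
      case True
      then show ?thesis
        using that[of p] \<open>k = K\<close> \<open>p < v k\<close> lstep_le[OF st(1)] by (auto simp: lstep_def)
    next
      case False
      then obtain i where "i < n (Suc K)" "v (Suc K) = v K + i * (m K - r (Suc K))"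
        using st \<open>p < v k\<close> \<open>k = K\<close> by (auto simp: lstep_def split: if_splits)
      then show ?thesis
        using that[of "p + i * (m K - r (Suc K))"] False \<open>p < v k\<close> \<open>k = K\<close> by (auto simp: lstep_def)
    qed
    obtain b where b: "b \<in> B" "f b (Suc K) = q" "below (Suc K) (f b) v"
      using Suc.prems(1)[of "Suc K" q] q by auto
    have "f b K = p"
      using lstep_inj[OF _ q(1)] branch_lstep[OF br[OF b(1)], of K] branch_less[OF br[OF b(1)], of K] b
        \<open>p < v k\<close> st(2) \<open>k = K\<close> by (metis less_trans)
    moreover have "below K (f b) v"
    proof (rule below_SucD[OF b(3)])
      show "f b K \<le> v K"
        using \<open>f b K = p\<close> \<open>p < v k\<close> \<open>k = K\<close> by simp
      show "f b K < r (Suc K) \<or> f b (Suc K) + v K = v (Suc K) + f b K"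
        using q(3) b(2) \<open>f b K = p\<close> by blast
    qed
    ultimately show ?thesis using b \<open>k = K\<close> by blast
  qed
  then show ?case using Suc.IH Suc.prems(2) by blast
qed simp

end

section \<open>Chains of branches\<close>

text \<open>A Rasiowa-Sikorski argument in which the path moves by single steps, because a branch
  needs a value at every level. It follows a shortest route to the current goal, so the distance
  drops until the goal is met and the next one is taken up.\<close>

lemma generic_path:
  fixes step :: "'s \<Rightarrow> 's \<Rightarrow> bool" and D :: "nat \<Rightarrow> 's \<Rightarrow> bool"
  assumes "V s0" and V_step: "\<And>s s'. V s \<Longrightarrow> step s s' \<Longrightarrow> V s'"
    and serial: "\<And>s. V s \<Longrightarrow> \<exists>s'. step s s'"
    and dense: "\<And>s j. V s \<Longrightarrow> \<exists>s'. step\<^sup>*\<^sup>* s s' \<and> D j s'"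
  shows "\<exists>p. p 0 = s0 \<and> (\<forall>i. step (p i) (p (Suc i))) \<and> (\<forall>j. \<exists>i. D j (p i))"
proof -
  define reach where "reach s j d \<longleftrightarrow> (\<exists>s'. (step ^^ d) s s' \<and> D j s')" for s j d
  define dist where "dist s j = (LEAST d. reach s j d)" for s j
  have reach_dist: "reach s j (dist s j)" if "V s" for s j
  proof -
    have "\<exists>d. reach s j d"
      using dense[OF that, of j] rtranclp_imp_relpowp unfolding reach_def by fast
    then show ?thesis unfolding dist_def by (rule LeastI_ex)
  qed
  have closer: "\<exists>s'. step s s' \<and> dist s' j < dist s j" if "V s" "\<not> D j s" for s j
  proof -
    obtain t where t: "(step ^^ dist s j) s t" "D j t"
      using reach_dist[OF \<open>V s\<close>] by (auto simp: reach_def)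
    then have "dist s j \<noteq> 0"
      using \<open>\<not> D j s\<close> by (metis relpowp_0_E)
    then obtain d where d: "dist s j = Suc d"
      using not0_implies_Suc by blast
    then obtain s' where "step s s'" "(step ^^ d) s' t"
      using t relpowp_Suc_D2 by metis
    then have "dist s' j \<le> d"
      unfolding dist_def using t(2) reach_def by (intro Least_le) blast
    then show ?thesis using \<open>step s s'\<close> d by auto
  qed
  \<comment> \<open>The second component is the index of the goal being pursued; once that goal is
    met, one arbitrary step is made and the index advances.\<close>
  define nxt where "nxt = (\<lambda>(s, j). if D j s then (SOME s'. step s s', Suc j)
     else (SOME s'. step s s' \<and> dist s' j < dist s j, j))"
  have nxt_D: "step s (fst (nxt (s, j)))" "snd (nxt (s, j)) = Suc j" if "V s" "D j s" for s j
    using serial[OF that(1)] that by (auto simp: nxt_def intro: someI_ex)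
  have nxt_nD: "step s (fst (nxt (s, j)))" "dist (fst (nxt (s, j))) j < dist s j" "snd (nxt (s, j)) = j"
    if "V s" "\<not> D j s" for s j
    using someI_ex[OF closer[OF that]] that by (auto simp: nxt_def)
  define z where "z i = (nxt ^^ i) (s0, 0)" for i
  have z_Suc: "z (Suc i) = nxt (fst (z i), snd (z i))" for i
    by (simp add: z_def)
  have V: "V (fst (z i))" for i
  proof (induction i)
    case (Suc i)
    then show ?case
      using nxt_D(1) nxt_nD(1) V_step unfolding z_Suc by metis
  qed (simp add: z_def assms(1))
  \<comment> \<open>By induction on the remaining distance, the pursued goal is met before it is
    changed.\<close>
  have hit: "\<exists>i'\<ge>i. snd (z i') = snd (z i) \<and> D (snd (z i)) (fst (z i'))" for i
  proof (induction "dist (fst (z i)) (snd (z i))" arbitrary: i rule: less_induct)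
    case less
    show ?case
    proof (cases "D (snd (z i)) (fst (z i))")
      case False
      from nxt_nD[OF V False, folded z_Suc] less[of "Suc i"] show ?thesis
        by (metis Suc_leD)
    qed auto
  qed
  have "\<exists>i. snd (z i) = j" for j
  proof (induction j)
    case (Suc j)
    then obtain i where "snd (z i) = j" "D j (fst (z i))"
      using hit by metis
    then show ?case using nxt_D(2)[OF V, of j i] z_Suc[of i] by metis
  qed (auto simp: z_def intro: exI[of _ 0])
  then have "\<exists>i. D j (fst (z i))" for j
    using hit by metis
  moreover have "step (fst (z i)) (fst (z (Suc i)))" for i
    using nxt_D(1) nxt_nD(1) V unfolding z_Suc by metis
  ultimately show ?thesis
    by (intro exI[of _ "fst \<circ> z"]) (simp add: z_def)
qed

locale scheme_order = scheme_type m n r for m n r :: "nat \<Rightarrow> nat" +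
  fixes W :: "'a rel" and E :: "'a \<Rightarrow> (nat \<times> nat) set"
  assumes W: "omega1_order W"
begin

abbreviation lt :: "'a \<Rightarrow> 'a \<Rightarrow> bool" (infix "\<sqsubset>" 50) where "a \<sqsubset> b \<equiv> lessW W a b"
abbreviation le :: "'a \<Rightarrow> 'a \<Rightarrow> bool" (infix "\<sqsubseteq>" 50) where "a \<sqsubseteq> b \<equiv> (a, b) \<in> W"

section \<open>Elementary facts about the order\<close>

lemma Well_W: "Well_order W"
  using W by (simp add: omega1_order_def)

lemma lt_Field: "a \<sqsubset> b \<Longrightarrow> a \<in> Field W \<and> b \<in> Field W"
  by (auto simp: lessW_def Field_def)

lemma le_Field: "a \<sqsubseteq> b \<Longrightarrow> a \<in> Field W \<and> b \<in> Field W"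
  by (auto simp: Field_def)

lemma le_refl: "a \<in> Field W \<Longrightarrow> a \<sqsubseteq> a"
  using Well_W by (auto simp: order_on_defs refl_on_def)

lemma le_iff: "b \<in> Field W \<Longrightarrow> a \<sqsubseteq> b \<longleftrightarrow> a = b \<or> a \<sqsubset> b"
  using le_refl by (auto simp: lessW_def)

lemma lt_imp_le: "a \<sqsubset> b \<Longrightarrow> a \<sqsubseteq> b"
  by (simp add: lessW_def)

lemma lt_irrefl [simp]: "\<not> a \<sqsubset> a"
  by (simp add: lessW_def)

lemma le_antisym: "a \<sqsubseteq> b \<Longrightarrow> b \<sqsubseteq> a \<Longrightarrow> a = b"
  using Well_W by (auto simp: order_on_defs antisym_def)

lemma le_trans: "a \<sqsubseteq> b \<Longrightarrow> b \<sqsubseteq> c \<Longrightarrow> a \<sqsubseteq> c"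
  using Well_W by (auto simp: order_on_defs trans_def)

lemma lt_le_trans: "a \<sqsubset> b \<Longrightarrow> b \<sqsubseteq> c \<Longrightarrow> a \<sqsubset> c"
  using le_trans le_antisym by (auto simp: lessW_def)

lemma le_lt_trans: "a \<sqsubseteq> b \<Longrightarrow> b \<sqsubset> c \<Longrightarrow> a \<sqsubset> c"
  using le_trans le_antisym by (auto simp: lessW_def)

lemma lt_trans: "a \<sqsubset> b \<Longrightarrow> b \<sqsubset> c \<Longrightarrow> a \<sqsubset> c"
  using lt_le_trans lt_imp_le by blast

lemma le_total: "a \<in> Field W \<Longrightarrow> b \<in> Field W \<Longrightarrow> a \<sqsubseteq> b \<or> b \<sqsubset> a"
  using Well_W le_refl by (cases "a = b") (auto simp: order_on_defs total_on_def lessW_def)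

lemma wf_lt: "wf {(b, a). b \<sqsubset> a}"
proof -
  have "{(b, a). b \<sqsubset> a} = W - Id"
    by (auto simp: lessW_def)
  then show ?thesis
    using Well_W by (simp add: well_order_on_def)
qed

lemma countable_le: "countable {b. b \<sqsubseteq> a}"
proof (cases "a \<in> Field W")
  case False
  then have "{b. b \<sqsubseteq> a} = {}" by (auto simp: Field_def)
  then show ?thesis by simp
qed (use W in \<open>auto simp: omega1_order_def\<close>)

lemma countable_lt: "countable {b. b \<sqsubset> a}"
  by (rule countable_subset[OF _ countable_le[of a]]) (auto simp: lessW_def)

lemma ex_least:
  assumes "P x"
  obtains y where "P y" "\<And>z. z \<sqsubset> y \<Longrightarrow> \<not> P z"
  using wfE_min[OF wf_lt, of x "{x. P x}"] assms by auto

definition limit :: "'a \<Rightarrow> bool" where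
  "limit a \<longleftrightarrow> (\<exists>b. b \<sqsubset> a) \<and> (\<forall>b. b \<sqsubset> a \<longrightarrow> (\<exists>c. b \<sqsubset> c \<and> c \<sqsubset> a))"

text \<open>The forcing clause. The set \<open>E e\<close> is tested against the path of
  \<open>v\<close> shifted by \<open>c\<close>, where \<open>c\<close> counts the passages to a
  predecessor already made. If the path stays inside, then some \<open>b\<close>, arbitrarily late
  below \<open>a\<close> and at an arbitrarily high level, has one plus its own path inside as well;
  at limits all \<open>n (Suc l)\<close> continuations are inside whenever the root ends just after
  \<open>b\<close>.\<close>

definition generic_at :: "('a \<Rightarrow> nat \<Rightarrow> nat) \<Rightarrow> 'a \<Rightarrow> (nat \<Rightarrow> nat) \<Rightarrow> bool" where
  "generic_at f a v \<longleftrightarrow>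
     (\<forall>e c j0 bs J. e \<sqsubset> a \<longrightarrow> (\<forall>j\<ge>j0. (j, v j + c) \<in> E e) \<longrightarrow> bs \<sqsubset> a \<longrightarrow>
        (\<exists>b j1. b \<sqsubset> a \<and> bs \<sqsubseteq> b \<and> J \<le> j1 \<and> v j1 = Suc (f b j1) \<and> below j1 (f b) v \<and>
           (\<forall>j\<ge>j1. (j, Suc (f b j) + c) \<in> E e) \<and>
           (limit a \<longrightarrow> (\<forall>l\<ge>j1. r (Suc l) = Suc (f b l) \<longrightarrow>
              (\<forall>i<n (Suc l). (Suc l, Suc (f b l) + c + i * (m l - r (Suc l))) \<in> E e)))))"

text \<open>The clauses on \<open>r\<close> supply levels where the root reaches a prescribed
  distance beyond an earlier ordinal while \<open>v\<close> stays put, or beyond \<open>v\<close>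
  itself. Later limit branches need such levels in order to jump; the free \<open>c\<close> in the
  clause about \<open>v\<close> absorbs the shift by 1 when a new branch is placed directly above an
  old one.\<close>

definition node_ok :: "('a \<Rightarrow> nat \<Rightarrow> nat) \<Rightarrow> 'a \<Rightarrow> (nat \<Rightarrow> nat) \<Rightarrow> bool" where
  "node_ok f a v \<longleftrightarrow> branch v \<and>
     (\<forall>b. b \<sqsubset> a \<longrightarrow> (\<exists>k. below k (f b) v \<and> f b k < v k)) \<and>
     (\<forall>k p. p < v k \<longrightarrow> (\<exists>b. b \<sqsubset> a \<and> f b k = p \<and> below k (f b) v)) \<and>
     (\<forall>b c J. b \<sqsubset> a \<longrightarrow> (\<exists>l>J. r (Suc l) = Suc (f b l) + c \<and> v (Suc l) = v l)) \<and>
     (\<forall>c J. \<exists>l>J. r (Suc l) = Suc (v l) + c) \<and>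
     (\<forall>b. b \<sqsubset> a \<longrightarrow> (\<forall>x. x \<sqsubset> a \<longrightarrow> x \<sqsubseteq> b) \<longrightarrow> (\<forall>k. Suc (f b k) < m k \<longrightarrow> v k = Suc (f b k))) \<and>
     generic_at f a v"

lemma
  assumes "node_ok f a v"
  shows node_branch: "branch v"
    and node_above: "b \<sqsubset> a \<Longrightarrow> \<exists>k. below k (f b) v \<and> f b k < v k"
    and node_filled: "p < v k \<Longrightarrow> \<exists>b. b \<sqsubset> a \<and> f b k = p \<and> below k (f b) v"
    and node_stall: "b \<sqsubset> a \<Longrightarrow> \<exists>l>J. r (Suc l) = Suc (f b l) + c \<and> v (Suc l) = v l"
    and node_root: "\<exists>l>J. r (Suc l) = Suc (v l) + c"
    and node_succ: "b \<sqsubset> a \<Longrightarrow> (\<And>x. x \<sqsubset> a \<Longrightarrow> x \<sqsubseteq> b) \<Longrightarrow> Suc (f b k) < m k \<Longrightarrow> v k = Suc (f b k)"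
  using assms unfolding node_ok_def by blast+

lemma node_generic:
  assumes "node_ok f a v" "e \<sqsubset> a" "\<forall>j\<ge>j0. (j, v j + c) \<in> E e" "bs \<sqsubset> a"
  shows "\<exists>b j1. b \<sqsubset> a \<and> bs \<sqsubseteq> b \<and> J \<le> j1 \<and> v j1 = Suc (f b j1) \<and> below j1 (f b) v \<and>
    (\<forall>j\<ge>j1. (j, Suc (f b j) + c) \<in> E e) \<and>
    (limit a \<longrightarrow> (\<forall>l\<ge>j1. r (Suc l) = Suc (f b l) \<longrightarrow>
       (\<forall>i<n (Suc l). (Suc l, Suc (f b l) + c + i * (m l - r (Suc l))) \<in> E e)))"
proof -
  have "generic_at f a v"
    using assms(1) by (simp add: node_ok_def)
  from this[unfolded generic_at_def, THEN spec[of _ e], THEN spec[of _ c], THEN spec[of _ j0],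
      THEN spec[of _ bs], THEN spec[of _ J], THEN mp, THEN mp, THEN mp, OF assms(2-4)]
  show ?thesis .
qed

text \<open>Only values of \<open>f\<close> strictly before \<open>a\<close> occur, as the
  well-founded recursion in \<open>ex_nodes\<close> demands.\<close>

lemma node_ok_cong:
  assumes "\<And>b. b \<sqsubset> a \<Longrightarrow> f b = g b"
  shows "node_ok f a v = node_ok g a v"
  unfolding node_ok_def generic_at_def using assms by (simp cong: conj_cong)

text \<open>Used with the predecessors of one stage during the construction and with all of
  \<open>Field W\<close> afterwards.\<close>

definition family :: "'a set \<Rightarrow> ('a \<Rightarrow> nat \<Rightarrow> nat) \<Rightarrow> bool" where
  "family B f \<longleftrightarrow> B \<subseteq> Field W \<and> (\<forall>a\<in>B. \<forall>b. b \<sqsubset> a \<longrightarrow> b \<in> B) \<and> (\<forall>a\<in>B. node_ok f a (f a))"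

context
  fixes B f
  assumes fam: "family B f"
begin

section \<open>Order and closure inside a chain\<close>

lemma fam_node: "b \<in> B \<Longrightarrow> node_ok f b (f b)"
  and fam_Field: "b \<in> B \<Longrightarrow> b \<in> Field W"
  and fam_down: "b \<in> B \<Longrightarrow> a \<sqsubset> b \<Longrightarrow> a \<in> B"
  using fam by (auto simp: family_def)

lemma fam_branch: "b \<in> B \<Longrightarrow> branch (f b)"
  using fam_node node_branch by blast

text \<open>Otherwise \<open>f b\<close> would eventually be below \<open>f a\<close>, whereas by
  \<open>below_less\<close> the strict inequality persists at all higher levels.\<close>

lemma fam_below_lt:
  assumes "a \<in> B" "b \<in> B" "below k (f a) (f b)" "f a k < f b k"
  shows "a \<sqsubset> b"
proof (rule ccontr)
  assume "\<not> a \<sqsubset> b"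
  then have "b = a \<or> b \<sqsubset> a"
    using assms fam_Field le_total[of b a] by (auto simp: lessW_def)
  then obtain k' where k': "below k' (f b) (f a)"
    using node_above[OF fam_node[OF assms(1)]] by (metis below_refl)
  have "f a (max k k') < f b (max k k')"
    using below_less[OF fam_branch[OF assms(1)] fam_branch[OF assms(2)] assms(3,4)] by simp
  moreover have "f b (max k k') \<le> f a (max k k')"
    using below_le[OF k'] by simp
  ultimately show False by simp
qed

lemma fam_inj:
  assumes "a \<in> B" "b \<in> B" "f a = f b"
  shows "a = b"
proof (rule ccontr)
  assume "a \<noteq> b"
  then have "a \<sqsubset> b \<or> b \<sqsubset> a"
    using assms fam_Field le_total[of a b] le_iff by blast
  then show False
    using node_above[OF fam_node[OF assms(1)]] node_above[OF fam_node[OF assms(2)]] assms(3) by fastforce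
qed

lemma fam_le_below:
  assumes "b \<in> B" "a \<sqsubseteq> b"
  obtains K where "\<And>k. k \<ge> K \<Longrightarrow> below k (f a) (f b)"
  using assms node_above[OF fam_node[OF assms(1)], of a] below_mono below_refl
  by (metis fam_Field le_iff)

lemma fam_le_down: "b \<in> B \<Longrightarrow> a \<sqsubseteq> b \<Longrightarrow> a \<in> B"
  using fam_Field[of b] fam_down[of b a] le_iff[of b a] by blast

text \<open>If \<open>f b\<close> were smaller at level \<open>k\<close>, then
  \<open>below_cut\<close> and \<open>fam_below_lt\<close> would put \<open>b\<close> strictly
  before \<open>a\<close>.\<close>

lemma fam_below_cut:
  assumes "c \<in> B" "b \<in> B" "a \<sqsubseteq> b" "below k (f a) (f c)" "below k (f b) (f c)"
  shows "below k (f a) (f b)"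
proof (rule below_cut)
  have a: "a \<in> B" using assms fam_le_down by blast
  show "branch (f a)" "branch (f b)" using a assms fam_branch by auto
  show "f a k \<le> f b k"
  proof (rule ccontr)
    assume "\<not> f a k \<le> f b k"
    then have less: "f b k < f a k" by simp
    have "below k (f b) (f a)"
      by (rule below_cut[of _ _ _ "f c"]) (use less a assms fam_branch in auto)
    then have "b \<sqsubset> a" using less fam_below_lt a assms by blast
    then show False using assms le_lt_trans lt_irrefl by blast
  qed
qed (use assms in auto)

lemma fam_below_eq:
  assumes "a \<in> B" "b \<in> B" "c \<in> B" "below k (f a) (f c)" "below k (f b) (f c)" "f a k = f b k"
  shows "a = b"
  by (intro fam_inj[OF assms(1,2)] below_antisym_at[OF fam_branch fam_branch assms(4-6)] assms(1,2))

lemma fam_successor: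
  assumes "b \<in> B" "\<exists>c\<in>B. b \<sqsubset> c"
  obtains c where "c \<in> B" "b \<sqsubset> c"
    "\<And>k. Suc (f b k) < m k \<Longrightarrow> f c k = Suc (f b k) \<and> below k (f b) (f c)"
proof -
  obtain c where c: "c \<in> B" "b \<sqsubset> c" "\<And>z. z \<sqsubset> c \<Longrightarrow> \<not> (z \<in> B \<and> b \<sqsubset> z)"
    using assms ex_least[of "\<lambda>c. c \<in> B \<and> b \<sqsubset> c"] by blast
  have pred: "x \<sqsubseteq> b" if "x \<sqsubset> c" for x
    using that c fam_down le_total[of x b] lt_Field by blast
  have val: "f c k = Suc (f b k)" if "Suc (f b k) < m k" for k
    using node_succ[OF fam_node[OF c(1)] c(2) pred that] .
  have "below k (f b) (f c)" if *: "Suc (f b k) < m k" for k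
    unfolding below_def
  proof (intro allI impI)
    fix j assume "k \<le> j"
    then have "Suc (f b j) < m j" "Suc (f b (Suc j)) < m (Suc j)"
      using branch_Suc_tail[OF fam_branch[OF assms(1)] *] by auto
    then show "f b j \<le> f c j \<and> (f b j < r (Suc j) \<or> f b (Suc j) + f c j = f c (Suc j) + f b j)"
      using val by simp
  qed
  then show ?thesis using that c val by blast
qed

text \<open>Each successor raises the position at level \<open>k\<close> by 1, until the last
  position of a level-\<open>k\<close> set is reached.\<close>

lemma fam_complete:
  assumes nomax: "\<And>b. b \<in> B \<Longrightarrow> \<exists>c\<in>B. b \<sqsubset> c" and "b \<in> B"
  obtains z where "z \<in> B" "below k (f b) (f z)" "f z k = m k - 1"
proof -
  have "\<exists>z\<in>B. below k (f b) (f z) \<and> f z k = m k - 1"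
    using assms(2)
  proof (induction "m k - f b k" arbitrary: b rule: less_induct)
    case less
    show ?case
    proof (cases "Suc (f b k) < m k")
      case True
      obtain c where c: "c \<in> B" "f c k = Suc (f b k)" "below k (f b) (f c)"
        using fam_successor[OF less.prems nomax[OF less.prems]] True by metis
      then have "m k - f c k < m k - f b k" using True by simp
      then obtain z where "z \<in> B" "below k (f c) (f z)" "f z k = m k - 1"
        using less.hyps c(1) by blast
      then show ?thesis using c below_trans by blast
    next
      case False
      then have "f b k = m k - 1"
        using branch_less[OF fam_branch[OF less.prems], of k] by simp
      then show ?thesis using less.prems below_refl by blast
    qed
  qed
  then show ?thesis using that by blast
qed

end

end

section \<open>Extending a chain\<close>

context scheme_order
begin

section \<open>The first stage and successor stages\<close>

lemma node_ok_minimal: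
  assumes "\<And>b. \<not> b \<sqsubset> a"
  shows "node_ok f a (\<lambda>_. 0)"
proof -
  have "\<exists>l>J. r (Suc l) = Suc 0 + c" for c J
    using r_recurs[of "Suc J" "Suc 0 + c"] by (metis Suc_le_lessD)
  moreover have "branch (\<lambda>_. 0)"
    by (simp add: branch_def m_pos lstep_refl)
  ultimately show ?thesis
    using assms by (simp add: node_ok_def generic_at_def)
qed

text \<open>The branch is one plus that of \<open>b\<close>, from a level on where this is a legal
  position. Most clauses are inherited from \<open>b\<close> with a shift by 1, and genericity is
  witnessed by \<open>b\<close> itself.\<close>

lemma node_ok_successor:
  assumes fam: "family {b. b \<sqsubset> a} f" and ba: "b \<sqsubset> a" and pred: "\<And>x. x \<sqsubset> a \<Longrightarrow> x \<sqsubseteq> b"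
  shows "\<exists>v. node_ok f a v"
proof -
  have node_b: "node_ok f b (f b)" and bb: "b \<in> {b. b \<sqsubset> a}"
    using fam_node[OF fam] ba by auto
  have br: "branch (f x)" if "x \<sqsubset> a" for x
    using fam_branch[OF fam] that by auto
  \<comment> \<open>Room for one more position, since \<open>r (Suc K) < m K\<close>.\<close>
  obtain K where "r (Suc K) = Suc (f b K)"
    using node_root[OF node_b, of 0 0] by auto
  then have K: "Suc (f b K) < m K"
    using r_less_m[of K] by simp
  have tail: "Suc (f b k) < m k \<and> lstep k (Suc (f b k)) (Suc (f b (Suc k)))" if "k \<ge> K" for k
    using branch_Suc_tail[OF br[OF ba] K that] lstep_Suc branch_lstep[OF br[OF ba]] by blast
  obtain v where v: "branch v" "\<And>k. k \<ge> K \<Longrightarrow> v k = Suc (f b k)"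
    using tail_extends_to_branch[OF tail] by blast
  have bv: "below k (f b) v" if "k \<ge> K" for k
    unfolding below_def using v(2) that by auto
  have "\<exists>k. below k (f x) v \<and> f x k < v k" if "x \<sqsubset> a" for x
  proof -
    have "x \<sqsubseteq> b" by (rule pred[OF that])
    then obtain k where k: "\<And>j. j \<ge> k \<Longrightarrow> below j (f x) (f b)"
      using fam_le_below[OF fam bb] by blast
    have "below (max k K) (f x) v"
      by (rule below_trans[OF k bv]) auto
    moreover have "f x (max k K) < v (max k K)"
      using below_le[OF k, of "max k K" "max k K"] v(2)[of "max k K"] by simp
    ultimately show ?thesis by blast
  qed
  moreover have "\<exists>x. x \<sqsubset> a \<and> f x k = p \<and> below k (f x) v" if "p < v k" for k p
  proof -
    have "\<exists>x\<in>{x. x \<sqsubset> a}. f x k = p \<and> below k (f x) v"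
    proof (rule positions_filled_down[OF v(1) _ _ that])
      fix k p assume k: "K \<le> k" and p: "p < v k"
      show "\<exists>x\<in>{x. x \<sqsubset> a}. f x k = p \<and> below k (f x) v"
      proof (cases "p = f b k")
        case True
        then show ?thesis using bb bv[OF k] by blast
      next
        case False
        then have "p < f b k" using p v(2)[OF k] by simp
        then obtain x where "x \<sqsubset> b" "f x k = p" "below k (f x) (f b)"
          using node_filled[OF node_b] by blast
        then show ?thesis using lt_trans[OF _ ba] below_trans[OF _ bv[OF k]] by blast
      qed
    qed (use br in blast)
    then show ?thesis by blast
  qed
  moreover have "\<exists>l>J. r (Suc l) = Suc (f x l) + c \<and> v (Suc l) = v l" if "x \<sqsubset> a" for x c J
  proof -
    have "\<exists>l>max J K. r (Suc l) = Suc (f x l) + c \<and> f b (Suc l) = f b l"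
    proof (cases "x = b")
      case True
      obtain l where l: "l > max J K" "r (Suc l) = Suc (f b l) + c"
        using node_root[OF node_b] by blast
      then have "f b (Suc l) = f b l"
        using lstep_root[OF branch_lstep[OF br[OF ba]], of l] by simp
      then show ?thesis using l True by blast
    next
      case False
      then have "x \<sqsubset> b" using pred[OF that] by (simp add: lessW_def)
      then show ?thesis using node_stall[OF node_b] by blast
    qed
    then show ?thesis using v(2) by fastforce
  qed
  moreover have "\<exists>l>J. r (Suc l) = Suc (v l) + c" for c J
  proof -
    \<comment> \<open>Asking \<open>b\<close> for \<open>Suc c\<close> compensates the shift by
      1.\<close>
    obtain l where "l > max J K" "r (Suc l) = Suc (f b l) + Suc c"
      using node_root[OF node_b] by blast
    then show ?thesis using v(2)[of l] by (intro exI[of _ l]) auto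
  qed
  moreover have "v k = Suc (f b' k)"
    if "b' \<sqsubset> a" "\<forall>x. x \<sqsubset> a \<longrightarrow> x \<sqsubseteq> b'" "Suc (f b' k) < m k" for b' k
  proof -
    have "b' = b" using that pred ba le_antisym by blast
    then have *: "Suc (f b j) < m j \<and> lstep j (Suc (f b j)) (Suc (f b (Suc j)))" if "j \<ge> k" for j
      using branch_Suc_tail[OF br[OF ba]] \<open>Suc (f b' k) < m k\<close> that lstep_Suc branch_lstep[OF br[OF ba]]
      by blast
    \<comment> \<open>Values of a branch are determined downwards, so \<open>v\<close> equals one
      plus the path of \<open>b\<close> also at levels below \<open>K\<close> where that position
      exists.\<close>
    obtain w where w: "branch w" "\<And>j. j \<ge> k \<Longrightarrow> w j = Suc (f b j)"
      using tail_extends_to_branch[OF *] by blast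
    then have "v k = w k"
      using branch_eq_below[OF v(1) w(1), of "max k K" k] v(2)[of "max k K"] by simp
    then show ?thesis using w \<open>b' = b\<close> by simp
  qed
  moreover have "generic_at f a v"
    unfolding generic_at_def
  proof (intro allI impI)
    fix e c j0 bs J
    assume T: "\<forall>j\<ge>j0. (j, v j + c) \<in> E e" and bs: "bs \<sqsubset> a"
    have "\<not> limit a"
      using pred ba le_lt_trans lt_irrefl unfolding limit_def by blast
    moreover have "(j, Suc (f b j) + c) \<in> E e" if "j \<ge> max J (max K j0)" for j
      using T v(2)[of j] that by (metis max.bounded_iff)
    moreover have "v (max J (max K j0)) = Suc (f b (max J (max K j0)))" "below (max J (max K j0)) (f b) v"
      using v(2) bv by auto
    ultimately show "\<exists>b j1. b \<sqsubset> a \<and> bs \<sqsubseteq> b \<and> J \<le> j1 \<and> v j1 = Suc (f b j1) \<and> below j1 (f b) v \<and>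
           (\<forall>j\<ge>j1. (j, Suc (f b j) + c) \<in> E e) \<and>
           (limit a \<longrightarrow> (\<forall>l\<ge>j1. r (Suc l) = Suc (f b l) \<longrightarrow>
              (\<forall>i<n (Suc l). (Suc l, Suc (f b l) + c + i * (m l - r (Suc l))) \<in> E e)))"
      using ba pred[OF bs] by (intro exI[of _ b] exI[of _ "max J (max K j0)"]) auto
  qed
  ultimately have "node_ok f a v"
    using v(1) unfolding node_ok_def by blast
  then show ?thesis by blast
qed

text \<open>The state \<open>(k, b)\<close> promises that the new branch takes the value \<open>Suc (f b k)\<close> at level \<open>k\<close>,
  that is, that \<open>b\<close> is the largest old ordinal in the level-\<open>k\<close> closure of the new one.\<close>

definition grow :: "'a \<Rightarrow> ('a \<Rightarrow> nat \<Rightarrow> nat) \<Rightarrow> nat \<times> 'a \<Rightarrow> nat \<times> 'a \<Rightarrow> bool" where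
  "grow a f s s' \<longleftrightarrow> fst s' = Suc (fst s) \<and>
     (snd s' = snd s \<or>
      (let k = fst s; b = snd s; b' = snd s' in
        r (Suc k) = Suc (f b k) \<and> b \<sqsubset> b' \<and> b' \<sqsubset> a \<and> below (Suc k) (f b) (f b') \<and>
        (\<exists>i\<ge>1. i < n (Suc k) \<and> Suc (f b' (Suc k)) = r (Suc k) + i * (m k - r (Suc k)))))"

lemma grow_quiet: "k \<le> k' \<Longrightarrow> (grow a f)\<^sup>*\<^sup>* (k, b) (k', b)"
proof (induction rule: dec_induct)
  case (step k')
  have "grow a f (k', b) (Suc k', b)" by (simp add: grow_def)
  then show ?case using step by (meson rtranclp.rtrancl_into_rtrancl)
qed simp

context
  fixes a f
  assumes lim: "limit a" and fam: "family {b. b \<sqsubset> a} f"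
begin

section \<open>Limit stages: finite approximations and their extensions\<close>

definition valid :: "nat \<times> 'a \<Rightarrow> bool" where
  "valid s \<longleftrightarrow> snd s \<sqsubset> a \<and> Suc (f (snd s) (fst s)) < m (fst s)"

lemma lim_node: "b \<sqsubset> a \<Longrightarrow> node_ok f b (f b)"
  and lim_branch: "b \<sqsubset> a \<Longrightarrow> branch (f b)"
  using fam_node[OF fam] fam_branch[OF fam] by auto

lemma lim_complete:
  assumes "b \<sqsubset> a"
  obtains z where "z \<sqsubset> a" "below k (f b) (f z)" "f z k = m k - 1"
proof -
  have "\<exists>z\<in>{b. b \<sqsubset> a}. x \<sqsubset> z" if "x \<in> {b. b \<sqsubset> a}" for x
    using lim that by (auto simp: limit_def)
  from fam_complete[OF fam this, of b k] show ?thesis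
    using assms that by blast
qed

lemma lim_le_below:
  assumes "b \<sqsubset> a" "x \<sqsubseteq> b"
  obtains K where "\<And>k. k \<ge> K \<Longrightarrow> below k (f x) (f b)"
  using fam_le_below[OF fam, of b x] assms by blast

text \<open>A jump is possible when the promised position \<open>Suc (f b k)\<close> is the first
  one outside the root. The new bound \<open>b'\<close> sits just before the start of block
  \<open>i\<close>, inside a full level-\<open>Suc k\<close> set with last element \<open>z\<close>,
  so the promise moves from \<open>r (Suc k)\<close> into block \<open>i\<close>.\<close>

lemma grow_block:
  assumes "b \<sqsubset> a" "r (Suc k) = Suc (f b k)" "z \<sqsubset> a" "below (Suc k) (f b) (f z)" "f z (Suc k) = m (Suc k) - 1"
    and i: "1 \<le> i" "i < n (Suc k)"
  obtains b' where "b' \<sqsubset> a" "grow a f (k, b) (Suc k, b')" "below (Suc k) (f b') (f z)"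
    "Suc (f b' (Suc k)) = r (Suc k) + i * (m k - r (Suc k))"
proof -
  define p where "p = f b k + i * (m k - r (Suc k))"
  have "p < f z (Suc k)"
    using block_add_le[OF i(2)] r_less_m[of k] assms(2,5) by (simp add: p_def)
  then obtain b' where b': "b' \<sqsubset> z" "f b' (Suc k) = p" "below (Suc k) (f b') (f z)"
    using node_filled[OF lim_node[OF assms(3)]] by blast
  have b'a: "b' \<sqsubset> a" using b'(1) assms(3) lt_trans by blast
  have "f b (Suc k) = f b k"
    using lstep_root[OF branch_lstep[OF lim_branch[OF assms(1)]], of k] assms(2) by simp
  moreover have "m k - r (Suc k) > 0"
    using r_less_m[of k] by simp
  ultimately have less: "f b (Suc k) < f b' (Suc k)"
    using i b'(2) by (simp add: p_def)
  then have below: "below (Suc k) (f b) (f b')"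
    using below_cut[OF lim_branch[OF assms(1)] lim_branch[OF b'a] assms(4) b'(3)] by simp
  then have "b \<sqsubset> b'"
    using fam_below_lt[OF fam _ _ below less] assms(1) b'a by blast
  then have "grow a f (k, b) (Suc k, b')"
    using assms(2) below i b'(2) b'a by (auto simp: grow_def p_def)
  then show ?thesis
    using that b'a b' assms(2) by (simp add: p_def)
qed

lemma valid_grow:
  assumes "valid s" "grow a f s s'"
  shows "valid s'"
proof -
  obtain k b b' where s: "s = (k, b)" "s' = (Suc k, b')"
    using assms(2) by (metis grow_def prod.collapse)
  have b: "b \<sqsubset> a" "Suc (f b k) < m k"
    using assms(1) s by (auto simp: valid_def)
  show ?thesis
  proof (cases "b' = b")
    case True
    then show ?thesis
      using b s branch_Suc_tail[OF lim_branch[OF b(1)] b(2), of "Suc k"] by (simp add: valid_def)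
  next
    case False
    then obtain i where "b' \<sqsubset> a" "i < n (Suc k)" "Suc (f b' (Suc k)) = r (Suc k) + i * (m k - r (Suc k))"
      using assms(2) s by (auto simp: grow_def Let_def)
    then show ?thesis
      using block_add_le[of i k] r_less_m[of k] s by (simp add: valid_def)
  qed
qed

text \<open>At a level where \<open>bs\<close> stalls and the root ends just after \<open>b\<close>,
  a jump into block 1 is made. The bound \<open>b'\<close> then has position \<open>m l - 1\<close>
  at level \<open>Suc l\<close>, while \<open>bs\<close> has not moved and is still under
  \<open>m l\<close>.\<close>

lemma reach_above:
  assumes "valid (k, b)" "bs \<sqsubset> a"
  obtains k' b' where "(grow a f)\<^sup>*\<^sup>* (k, b) (k', b')" "bs \<sqsubseteq> b'"
proof (cases "bs \<sqsubseteq> b")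
  case False
  have ba: "b \<sqsubset> a" using assms(1) by (simp add: valid_def)
  then have "b \<sqsubset> bs"
    using False assms(2) lt_Field le_total by blast
  obtain K where K: "\<And>k. k \<ge> K \<Longrightarrow> below k (f b) (f bs)"
    using lim_le_below[OF assms(2) lt_imp_le[OF \<open>b \<sqsubset> bs\<close>]] by blast
  obtain l where l: "l > max k K" "r (Suc l) = Suc (f b l)" "f bs (Suc l) = f bs l"
    using node_stall[OF lim_node[OF assms(2)] \<open>b \<sqsubset> bs\<close>, of "max k K" 0] by auto
  obtain z where z: "z \<sqsubset> a" "below (Suc l) (f bs) (f z)" "f z (Suc l) = m (Suc l) - 1"
    using lim_complete[OF assms(2), of "Suc l"] by blast
  have "below (Suc l) (f b) (f z)"
    using K[of "Suc l"] l(1) z(2) below_trans by simp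
  then obtain b' where b': "b' \<sqsubset> a" "grow a f (l, b) (Suc l, b')" "below (Suc l) (f b') (f z)"
    "Suc (f b' (Suc l)) = r (Suc l) + 1 * (m l - r (Suc l))"
    using grow_block[OF ba l(2) z(1) _ z(3), of 1] n_ge2[of l] by auto
  have le: "f bs (Suc l) \<le> f b' (Suc l)"
    using b'(4) l(3) branch_less[OF lim_branch[OF assms(2)], of l] r_less_m[of l] by linarith
  have "below (Suc l) (f bs) (f b')"
    by (rule below_cut[OF lim_branch[OF assms(2)] lim_branch[OF b'(1)] z(2) b'(3) le])
  then have "bs \<sqsubseteq> b'"
    using fam_below_lt[OF fam, of bs b' "Suc l"] fam_below_eq[OF fam, of bs b' b' "Suc l"] le
      assms(2) b'(1) le_refl lt_Field lt_imp_le below_refl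
    by (metis le_neq_implies_less mem_Collect_eq)
  moreover have "(grow a f)\<^sup>*\<^sup>* (k, b) (Suc l, b')"
    using grow_quiet[of k l a f b] b'(2) l(1) by (simp add: rtranclp.rtrancl_into_rtrancl)
  ultimately show ?thesis using that by blast
qed (use that in blast)

lemma valid_reach: "(grow a f)\<^sup>*\<^sup>* s s' \<Longrightarrow> valid s \<Longrightarrow> valid s'"
  by (induction rule: rtranclp_induct) (auto intro: valid_grow)

section \<open>Requirements for the new branch\<close>

definition leaves :: "nat \<Rightarrow> (nat \<times> nat) set \<Rightarrow> nat \<times> 'a \<Rightarrow> bool" where
  "leaves c T s \<longleftrightarrow> (fst s, Suc (f (snd s) (fst s)) + c) \<notin> T"

definition req_above :: "'a \<Rightarrow> nat \<times> 'a \<Rightarrow> bool" where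
  "req_above bs s \<longleftrightarrow> bs \<sqsubseteq> snd s"

text \<open>This and \<open>req_root\<close> speak of the level \<open>Suc l\<close> already
  reached: a promised position under \<open>m l\<close>, respectively inside the root, must have
  been the same at level \<open>l\<close>.\<close>

definition req_stall :: "'a \<times> nat \<times> nat \<Rightarrow> nat \<times> 'a \<Rightarrow> bool" where
  "req_stall = (\<lambda>(x, c, J) (k, b). \<exists>l>J. k = Suc l \<and> r (Suc l) = Suc (f x l) + c \<and> Suc (f b k) < m l)"

definition req_root :: "nat \<times> nat \<Rightarrow> nat \<times> 'a \<Rightarrow> bool" where
  "req_root = (\<lambda>(c, J) (k, b). \<exists>l>J. k = Suc l \<and> r (Suc l) = Suc (Suc (f b k)) + c)"

text \<open>The decision of forcing. A branch that stays inside the coded set can meet it only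
  through the second alternative, which constrains all extensions and not just the branch.\<close>

definition req_decide :: "'a \<times> nat \<times> nat \<Rightarrow> nat \<times> 'a \<Rightarrow> bool" where
  "req_decide = (\<lambda>(e, c, J) s. J \<le> fst s \<and>
     (leaves c (E e) s \<or> (\<forall>s'. (grow a f)\<^sup>*\<^sup>* s s' \<longrightarrow> \<not> leaves c (E e) s')))"

definition reqs :: "(nat \<times> 'a \<Rightarrow> bool) set" where
  "reqs = req_above ` {b. b \<sqsubset> a} \<union> req_stall ` ({b. b \<sqsubset> a} \<times> UNIV) \<union> range req_root \<union>
     req_decide ` ({b. b \<sqsubset> a} \<times> UNIV)"

lemma countable_reqs: "countable reqs"
  unfolding reqs_def by (intro countable_Un countable_image countable_SIGMA countable_lt countableI_type)

text \<open>After climbing to or above \<open>x\<close>, the bound \<open>b\<close> is kept until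
  one of its own stalling levels for \<open>x\<close>, or one of its root levels if
  \<open>x = b\<close>.\<close>

lemma reach_stall:
  assumes "valid s" "x \<sqsubset> a"
  shows "\<exists>s'. (grow a f)\<^sup>*\<^sup>* s s' \<and> req_stall (x, c, J) s'"
proof -
  obtain k b where kb: "(grow a f)\<^sup>*\<^sup>* s (k, b)" "x \<sqsubseteq> b"
    using reach_above[of "fst s" "snd s" x] assms by auto
  then have v: "b \<sqsubset> a" "Suc (f b k) < m k"
    using valid_reach[OF kb(1) assms(1)] by (auto simp: valid_def)
  have "\<exists>l>max k J. r (Suc l) = Suc (f x l) + c \<and> f b (Suc l) = f b l"
  proof (cases "x = b")
    case True
    obtain l where l: "l > max k J" "r (Suc l) = Suc (f b l) + c"
      using node_root[OF lim_node[OF v(1)]] by blast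
    then have "f b (Suc l) = f b l"
      using lstep_root[OF branch_lstep[OF lim_branch[OF v(1)]], of l] by simp
    then show ?thesis using l True by blast
  next
    case False
    then have "x \<sqsubset> b" using kb(2) by (simp add: lessW_def)
    then show ?thesis using node_stall[OF lim_node[OF v(1)]] by blast
  qed
  then obtain l where l: "l > max k J" "r (Suc l) = Suc (f x l) + c" "f b (Suc l) = f b l"
    by blast
  then have "req_stall (x, c, J) (Suc l, b)"
    using branch_Suc_tail[OF lim_branch[OF v(1)] v(2), of l] by (simp add: req_stall_def)
  moreover have "(grow a f)\<^sup>*\<^sup>* s (Suc l, b)"
    using kb(1) grow_quiet[of k "Suc l" a f b] l(1) by simp
  ultimately show ?thesis by blast
qed

lemma reach_root:
  assumes "valid s"
  shows "\<exists>s'. (grow a f)\<^sup>*\<^sup>* s s' \<and> req_root (c, J) s'"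
proof -
  obtain k b where s: "s = (k, b)" by (cases s)
  have ba: "b \<sqsubset> a" using assms s by (simp add: valid_def)
  obtain l where l: "l > max k J" "r (Suc l) = Suc (f b l) + Suc c"
    using node_root[OF lim_node[OF ba]] by blast
  then have "f b (Suc l) = f b l"
    using lstep_root[OF branch_lstep[OF lim_branch[OF ba]], of l] by simp
  then have "req_root (c, J) (Suc l, b)"
    using l by (simp add: req_root_def)
  moreover have "(grow a f)\<^sup>*\<^sup>* s (Suc l, b)"
    using grow_quiet[of k "Suc l" a f b] l(1) s by simp
  ultimately show ?thesis by blast
qed

lemma grow_fst: "(grow a f)\<^sup>*\<^sup>* s s' \<Longrightarrow> fst s \<le> fst s'"
  by (induction rule: rtranclp_induct) (auto simp: grow_def)

lemma reach_decide: "\<exists>s'. (grow a f)\<^sup>*\<^sup>* s s' \<and> req_decide (e, c, J) s'"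
proof -
  define s1 where "s1 = (max J (fst s), snd s)"
  have s1: "(grow a f)\<^sup>*\<^sup>* s s1"
    using grow_quiet[of "fst s" "max J (fst s)" a f "snd s"] by (simp add: s1_def)
  show ?thesis
  proof (cases "\<exists>s'. (grow a f)\<^sup>*\<^sup>* s1 s' \<and> leaves c (E e) s'")
    case True
    then obtain s' where s': "(grow a f)\<^sup>*\<^sup>* s1 s'" "leaves c (E e) s'" by blast
    moreover have "J \<le> fst s'"
      using grow_fst[OF s'(1)] by (simp add: s1_def)
    ultimately have "req_decide (e, c, J) s'"
      by (simp add: req_decide_def)
    then show ?thesis
      using rtranclp_trans[OF s1 s'(1)] by blast
  next
    case False
    then have "req_decide (e, c, J) s1"
      by (auto simp: req_decide_def s1_def)
    then show ?thesis using s1 by blast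
  qed
qed

lemma reach_reqs:
  assumes "valid s" "Q \<in> reqs"
  shows "\<exists>s'. (grow a f)\<^sup>*\<^sup>* s s' \<and> Q s'"
proof -
  consider bs where "bs \<sqsubset> a" "Q = req_above bs" | x c J where "x \<sqsubset> a" "Q = req_stall (x, c, J)"
    | c J where "Q = req_root (c, J)" | e c J where "Q = req_decide (e, c, J)"
    using assms(2) unfolding reqs_def by (elim UnE imageE) auto
  then show ?thesis
  proof cases
    case 1
    obtain k' b' where "(grow a f)\<^sup>*\<^sup>* s (k', b')" "bs \<sqsubseteq> b'"
      using reach_above[of "fst s" "snd s" bs] assms(1) 1(1) by auto
    then show ?thesis
      unfolding 1(2) by (intro exI[of _ "(k', b')"]) (simp add: req_above_def)
  next
    case 2
    then show ?thesis using reach_stall[OF assms(1)] by simp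
  next
    case 3
    then show ?thesis using reach_root[OF assms(1)] by simp
  next
    case 4
    then show ?thesis using reach_decide by simp
  qed
qed

text \<open>A path of approximations that meets the countably many requirements yields the branch
  \<open>y\<close>. The requirements give cofinality, stalls, roots and genericity; the positions
  are filled by the current bound and its predecessors.\<close>

lemma node_ok_limit: "\<exists>v. node_ok f a v"
proof -
  obtain b0 where b0: "b0 \<sqsubset> a" using lim by (auto simp: limit_def)
  obtain k0 where "r (Suc k0) = Suc (f b0 k0)"
    using node_root[OF lim_node[OF b0], of 0 0] by auto
  then have v0: "valid (k0, b0)"
    using b0 r_less_m[of k0] by (simp add: valid_def)
  have ne: "reqs \<noteq> {}" by (auto simp: reqs_def)
  have serial: "\<exists>s'. grow a f s s'" for s
    by (intro exI[of _ "(Suc (fst s), snd s)"]) (simp add: grow_def)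
  have dense: "\<exists>s'. (grow a f)\<^sup>*\<^sup>* s s' \<and> from_nat_into reqs j s'" if "valid s" for s j
    using reach_reqs[OF that from_nat_into[OF ne]] .
  have "\<exists>p. p 0 = (k0, b0) \<and> (\<forall>i. grow a f (p i) (p (Suc i))) \<and> (\<forall>j. \<exists>i. from_nat_into reqs j (p i))"
    by (rule generic_path[of valid]) (use v0 valid_grow serial dense in \<open>assumption | blast\<close>)+
  then obtain p where p0: "p 0 = (k0, b0)" and grow: "\<And>i. grow a f (p i) (p (Suc i))"
    and hit: "\<And>j. \<exists>i. from_nat_into reqs j (p i)"
    by blast
  have met: "\<exists>i. Q (p i)" if "Q \<in> reqs" for Q
    using hit[of "to_nat_on reqs Q"] that countable_reqs by simp
  define b where "b i = snd (p i)" for i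
  have fst_p: "fst (p i) = k0 + i" for i
    by (induction i) (use grow in \<open>auto simp: grow_def p0\<close>)
  have p: "p i = (k0 + i, b i)" for i
    by (simp add: b_def fst_p[symmetric])
  have path: "(grow a f)\<^sup>*\<^sup>* (p i) (p j)" if "i \<le> j" for i j
    using that by (induction rule: dec_induct) (auto intro: grow rtranclp.rtrancl_into_rtrancl)
  have valid_p: "valid (p i)" for i
    using valid_reach[OF path[of 0 i]] v0 p0 by simp
  then have ba: "b i \<sqsubset> a" and b_less: "Suc (f (b i) (k0 + i)) < m (k0 + i)" for i
    by (auto simp: valid_def p)
  have br: "branch (f (b i))" for i using lim_branch ba by blast
  have tail: "Suc (f (b (k - k0)) k) < m k \<and> lstep k (Suc (f (b (k - k0)) k)) (Suc (f (b (Suc k - k0)) (Suc k)))"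
    if "k \<ge> k0" for k
  proof
    define i where "i = k - k0"
    have k: "k = k0 + i" "Suc k - k0 = Suc i" using that by (auto simp: i_def)
    show "Suc (f (b (k - k0)) k) < m k" using b_less[of i] k by simp
    show "lstep k (Suc (f (b (k - k0)) k)) (Suc (f (b (Suc k - k0)) (Suc k)))"
    proof (cases "b (Suc i) = b i")
      case True
      then show ?thesis using k lstep_Suc[OF branch_lstep[OF br]] by simp
    next
      case False
      then show ?thesis
        using grow[of i] k by (auto simp: grow_def p Let_def lstep_def)
    qed
  qed
  obtain y where y: "branch y" "\<And>k. k \<ge> k0 \<Longrightarrow> y k = Suc (f (b (k - k0)) k)"
    using tail_extends_to_branch[of k0 "\<lambda>k. Suc (f (b (k - k0)) k)", OF tail] by blast
  have y_p: "y (k0 + i) = Suc (f (b i) (k0 + i))" for i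
    using y(2)[of "k0 + i"] by simp
  have b_step: "b i \<sqsubseteq> b (Suc i)" "below (Suc (k0 + i)) (f (b i)) (f (b (Suc i)))" for i
    using grow[of i] ba[of i] lt_Field le_refl by (auto simp: grow_def p Let_def lessW_def)
  have b_mono: "b i \<sqsubseteq> b j" if "i \<le> j" for i j
    using that by (induction rule: dec_induct) (use b_step ba lt_Field le_refl le_trans in blast)+
  have b_below: "below (k0 + j) (f (b i)) (f (b j))" if "i \<le> j" for i j
    using that
  proof (induction rule: dec_induct)
    case (step j)
    then have "below (k0 + Suc j) (f (b i)) (f (b j))"
      using below_mono by fastforce
    then show ?case using b_step(2)[of j] below_trans by simp
  qed simp
  \<comment> \<open>The bound is replaced only when the root ends right after it. So if an earlier
    bound is outside the root, no replacement happens at this step, and both positions move by the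
    same amount.\<close>
  have b_y: "below (k0 + i) (f (b i)) y" for i
    unfolding below_def
  proof (intro allI impI)
    fix j assume "k0 + i \<le> j"
    then obtain i' where i': "j = k0 + i'" "i \<le> i'"
      by (metis add_leD1 add_le_cancel_left le_iff_add)
    have le: "f (b i) j \<le> f (b i') j"
      using below_le[OF b_below[OF i'(2)]] i'(1) by simp
    have "f (b i) (Suc j) + y j = y (Suc j) + f (b i) j" if ge: "r (Suc j) \<le> f (b i) j"
    proof -
      have "b (Suc i') = b i'"
        using grow[of i'] le ge i'(1) by (auto simp: grow_def p Let_def)
      moreover have "below (k0 + i') (f (b i)) (f (b i'))" by (rule b_below[OF i'(2)])
      ultimately show ?thesis
        using below_shift[of "k0 + i'" "f (b i)" "f (b i')" j] y_p[of i'] y_p[of "Suc i'"] i'(1) ge by simp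
    qed
    then show "f (b i) j \<le> y j \<and> (f (b i) j < r (Suc j) \<or> f (b i) (Suc j) + y j = y (Suc j) + f (b i) j)"
      using le y_p[of i'] i'(1) by (metis le_Suc_eq le_trans not_le)
  qed
  have cofinal: "\<exists>i. bs \<sqsubseteq> b i" if "bs \<sqsubset> a" for bs
    using met[of "req_above bs"] that by (auto simp: reqs_def req_above_def p)
  have "\<exists>k. below k (f x) y \<and> f x k < y k" if xa: "x \<sqsubset> a" for x
  proof -
    obtain i where i: "x \<sqsubseteq> b i" using cofinal[OF xa] by blast
    obtain K where K: "\<And>k. k \<ge> K \<Longrightarrow> below k (f x) (f (b i))"
      using lim_le_below[OF ba i] by blast
    define k where "k = max K (k0 + i)"
    have "below k (f x) y"
      by (rule below_trans[OF K below_mono[OF b_y]]) (simp_all add: k_def)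
    moreover have "f (b i) k < y k"
      using below_less[OF br y(1) b_y, of i k] y_p[of i] by (simp add: k_def)
    ultimately show ?thesis
      using below_le[OF K, of k k] by (intro exI[of _ k]) (simp add: k_def)
  qed
  moreover have "\<exists>x. x \<sqsubset> a \<and> f x k = q \<and> below k (f x) y" if qk: "q < y k" for k q
  proof -
    have "\<exists>x\<in>{x. x \<sqsubset> a}. f x k = q \<and> below k (f x) y"
    proof (rule positions_filled_down[OF y(1) _ _ qk])
      fix k q assume k: "k0 \<le> k" and q: "q < y k"
      then obtain i where i: "k = k0 + i" using le_iff_add by blast
      show "\<exists>x\<in>{x. x \<sqsubset> a}. f x k = q \<and> below k (f x) y"
      proof (cases "q = f (b i) k")
        case True
        then show ?thesis using ba b_y i by blast
      next
        case False
        then have "q < f (b i) k" using q y_p i by simp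
        then obtain x where "x \<sqsubset> b i" "f x k = q" "below k (f x) (f (b i))"
          using node_filled[OF lim_node[OF ba]] by blast
        then show ?thesis using lt_trans[OF _ ba] below_trans[OF _ b_y] i by blast
      qed
    qed (use lim_branch in blast)
    then show ?thesis by blast
  qed
  moreover have "\<exists>l>J. r (Suc l) = Suc (f x l) + c \<and> y (Suc l) = y l" if xa: "x \<sqsubset> a" for x c J
  proof -
    obtain i where "req_stall (x, c, J) (p i)"
      using met[of "req_stall (x, c, J)"] xa by (auto simp: reqs_def)
    then obtain l where l: "l > J" "k0 + i = Suc l" "r (Suc l) = Suc (f x l) + c" "Suc (f (b i) (Suc l)) < m l"
      by (auto simp: req_stall_def p)
    then have "y (Suc l) = y l"
      using lstep_stay[OF branch_lstep[OF y(1)]] y_p[of i] by simp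
    then show ?thesis using l by blast
  qed
  moreover have "\<exists>l>J. r (Suc l) = Suc (y l) + c" for c J
  proof -
    obtain i where "req_root (c, J) (p i)"
      using met[of "req_root (c, J)"] by (auto simp: reqs_def)
    then obtain l where l: "l > J" "k0 + i = Suc l" "r (Suc l) = Suc (Suc (f (b i) (Suc l))) + c"
      by (auto simp: req_root_def p)
    then have "y (Suc l) = y l"
      using lstep_root[OF branch_lstep[OF y(1)], of l] y_p[of i] by simp
    then show ?thesis using l y_p[of i] by (intro exI[of _ l]) auto
  qed
  moreover have "\<not> (x \<sqsubset> a \<and> (\<forall>z. z \<sqsubset> a \<longrightarrow> z \<sqsubseteq> x))" for x
    using lim le_lt_trans lt_irrefl unfolding limit_def by blast
  moreover have "generic_at f a y"
    unfolding generic_at_def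
  proof (intro allI impI)
    fix e c j0 bs J
    assume ea: "e \<sqsubset> a" and T: "\<forall>j\<ge>j0. (j, y j + c) \<in> E e" and bs: "bs \<sqsubset> a"
    obtain i where i: "req_decide (e, c, j0) (p i)"
      using met[of "req_decide (e, c, j0)"] ea by (auto simp: reqs_def)
    \<comment> \<open>The decision is made at a level at least \<open>j0\<close>, where the branch
      is known to be inside, so its first alternative fails.\<close>
    then have "\<not> leaves c (E e) (p i)"
      using T y_p[of i] by (auto simp: req_decide_def leaves_def p)
    with i have stay: "\<not> leaves c (E e) s'" if "(grow a f)\<^sup>*\<^sup>* (p i) s'" for s'
      using that unfolding req_decide_def by blast
    obtain i' where i': "bs \<sqsubseteq> b i'" using cofinal[OF bs] by blast
    define i2 where "i2 = max J (max i i')"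
    have path2: "(grow a f)\<^sup>*\<^sup>* (p i) (p i2)"
      by (rule path) (simp add: i2_def)
    have quiet: "(grow a f)\<^sup>*\<^sup>* (p i) (j, b i2)" if "j \<ge> k0 + i2" for j
      using rtranclp_trans[OF path2] grow_quiet[OF that] p by metis
    have "b i2 \<sqsubset> a" "bs \<sqsubseteq> b i2" "J \<le> k0 + i2" "y (k0 + i2) = Suc (f (b i2) (k0 + i2))"
      "below (k0 + i2) (f (b i2)) y"
      using ba le_trans[OF i' b_mono] y_p b_y by (auto simp: i2_def)
    moreover have "(j, Suc (f (b i2) j) + c) \<in> E e" if "j \<ge> k0 + i2" for j
      using stay[OF quiet[OF that]] by (simp add: leaves_def)
    moreover have "(Suc l, Suc (f (b i2) l) + c + d * (m l - r (Suc l))) \<in> E e"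
      if l: "l \<ge> k0 + i2" and rl: "r (Suc l) = Suc (f (b i2) l)" and d: "d < n (Suc l)" for l d
    \<comment> \<open>Block 0 is reached by keeping the bound, any other block by an actual jump;
      both extend the deciding approximation.\<close>
    proof (cases d)
      case 0
      have "f (b i2) (Suc l) = f (b i2) l"
        using lstep_root[OF branch_lstep[OF br[of i2], of l]] rl by simp
      then show ?thesis
        using stay[OF quiet[of "Suc l"]] l 0 by (simp add: leaves_def)
    next
      case (Suc d')
      obtain z where z: "z \<sqsubset> a" "below (Suc l) (f (b i2)) (f z)" "f z (Suc l) = m (Suc l) - 1"
        using lim_complete[OF ba, of "Suc l"] by blast
      obtain b' where b': "grow a f (l, b i2) (Suc l, b')"
        "Suc (f b' (Suc l)) = r (Suc l) + d * (m l - r (Suc l))"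
        using grow_block[OF ba rl z _ d] Suc by auto
      then have "(grow a f)\<^sup>*\<^sup>* (p i) (Suc l, b')"
        using quiet[OF l] by (meson rtranclp.rtrancl_into_rtrancl)
      from stay[OF this] have "(Suc l, Suc (f b' (Suc l)) + c) \<in> E e"
        by (simp add: leaves_def)
      moreover have "Suc (f b' (Suc l)) + c = Suc (f (b i2) l) + c + d * (m l - r (Suc l))"
        using b'(2) rl by linarith
      ultimately show ?thesis by (simp only:)
    qed
    ultimately show "\<exists>b j1. b \<sqsubset> a \<and> bs \<sqsubseteq> b \<and> J \<le> j1 \<and> y j1 = Suc (f b j1) \<and> below j1 (f b) y \<and>
           (\<forall>j\<ge>j1. (j, Suc (f b j) + c) \<in> E e) \<and>
           (limit a \<longrightarrow> (\<forall>l\<ge>j1. r (Suc l) = Suc (f b l) \<longrightarrow>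
              (\<forall>i<n (Suc l). (Suc l, Suc (f b l) + c + i * (m l - r (Suc l))) \<in> E e)))"
      by (intro exI[of _ "b i2"] exI[of _ "k0 + i2"]) blast
  qed
  ultimately have "node_ok f a y"
    using y(1) unfolding node_ok_def by blast
  then show ?thesis by blast
qed

end

lemma ex_nodes: "\<exists>f. \<forall>a. node_ok f a (f a)"
proof (rule dependent_wf_choice[OF wf_lt])
  fix a and f :: "'a \<Rightarrow> nat \<Rightarrow> nat"
  assume "\<And>b. (b, a) \<in> {(b, a). b \<sqsubset> a} \<Longrightarrow> node_ok f b (f b)"
  then have fam: "family {b. b \<sqsubset> a} f"
    using lt_trans lt_Field by (auto simp: family_def)
  consider "\<And>b. \<not> b \<sqsubset> a" | b where "b \<sqsubset> a" "\<And>x. x \<sqsubset> a \<Longrightarrow> x \<sqsubseteq> b" | "limit a"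
    using le_total lt_Field unfolding limit_def by metis
  then show "\<exists>v. node_ok f a v"
  proof cases
    case 1
    then show ?thesis using node_ok_minimal by blast
  next
    case (2 b)
    then show ?thesis using node_ok_successor[OF fam] by blast
  next
    case 3
    then show ?thesis using node_ok_limit[OF _ fam] by blast
  qed
next
  fix f g :: "'a \<Rightarrow> nat \<Rightarrow> nat" and a v
  assume "\<And>z. (z, a) \<in> {(b, a). b \<sqsubset> a} \<Longrightarrow> f z = g z"
  then show "node_ok f a v = node_ok g a v"
    by (intro node_ok_cong) auto
qed

end

section \<open>The scheme of a chain\<close>

lemma strict_chain_id:
  fixes g :: "nat \<Rightarrow> nat"
  assumes step: "\<And>i. Suc i < N \<Longrightarrow> g i < g (Suc i)" and bound: "\<And>i. i < N \<Longrightarrow> g i < N" and "i < N"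
  shows "g i = i"
proof -
  have grow: "g i + (j - i) \<le> g j" if "i \<le> j" "j < N" for i j
    using that
  proof (induction rule: dec_induct)
    case (step j)
    then show ?case using assms(1)[of j] by simp
  qed simp
  show ?thesis
    using grow[of 0 i] grow[of i "N - 1"] bound[of "N - 1"] \<open>i < N\<close> by fastforce
qed

locale scheme_tower = scheme_order m n r W E
  for m n r :: "nat \<Rightarrow> nat" and W :: "'a rel" and E :: "'a \<Rightarrow> (nat \<times> nat) set" +
  fixes f :: "'a \<Rightarrow> nat \<Rightarrow> nat"
  assumes nodes: "\<And>a. node_ok f a (f a)"
begin

section \<open>Closures as initial intervals of positions\<close>

definition cl :: "'a \<Rightarrow> nat \<Rightarrow> 'a set" where
  "cl a k = {b. b \<sqsubseteq> a \<and> below k (f b) (f a)}"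

definition top_at :: "nat \<Rightarrow> 'a \<Rightarrow> bool" where
  "top_at k a \<longleftrightarrow> a \<in> Field W \<and> f a k = m k - 1"

text \<open>Admitting only closures whose last element has the last position gives every member the
  size \<open>m k\<close> of its level.\<close>

definition scheme :: "'a set set" where
  "scheme = {cl a k | a k. top_at k a}"

lemma fam_all: "family (Field W) f"
  using nodes lt_Field by (auto simp: family_def)

lemma f_branch: "branch (f a)"
  using nodes node_branch by blast

lemma f_less: "f a k < m k"
  and f_lstep: "lstep k (f a k) (f a (Suc k))"
  using branch_less branch_lstep f_branch by blast+

lemma no_max: "a \<in> Field W \<Longrightarrow> \<exists>c\<in>Field W. a \<sqsubset> c"
proof (rule ccontr)
  assume a: "a \<in> Field W" and "\<not> (\<exists>c\<in>Field W. a \<sqsubset> c)"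
  then have "Field W \<subseteq> {b. b \<sqsubseteq> a}"
    using le_total by blast
  then have "countable (Field W)"
    using countable_le countable_subset by blast
  then show False using W by (simp add: omega1_order_def)
qed

lemma ex_top_above:
  assumes "a \<in> Field W"
  obtains z where "top_at k z" "a \<in> cl z k"
proof -
  obtain z where z: "z \<in> Field W" "below k (f a) (f z)" "f z k = m k - 1"
    using fam_complete[OF fam_all no_max assms, of k] by blast
  have "a \<sqsubseteq> z"
  proof (cases "f a k = f z k")
    case True
    then have "a = z"
      using fam_below_eq[OF fam_all assms z(1) z(1) z(2)] by simp
    then show ?thesis using le_refl assms by simp
  next
    case False
    then have "f a k < f z k"
      using below_le[OF z(2), of k] by simp
    then show ?thesis
      using fam_below_lt[OF fam_all assms z(1,2)] lt_imp_le by blast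
  qed
  then show ?thesis using that z by (auto simp: cl_def top_at_def)
qed

lemma cl_self: "a \<in> Field W \<Longrightarrow> a \<in> cl a k"
  by (simp add: cl_def le_refl)

lemma cl_Field: "x \<in> cl a k \<Longrightarrow> x \<in> Field W"
  and cl_Field': "x \<in> cl a k \<Longrightarrow> a \<in> Field W"
  using le_Field by (auto simp: cl_def)

text \<open>Injectivity is \<open>fam_below_eq\<close>, surjectivity is \<open>node_filled\<close>.
  Together with \<open>cl_lt_iff\<close> this makes \<open>f x k\<close> the rank of
  \<open>x\<close> in any level-\<open>k\<close> closure containing it.\<close>

lemma cl_bij: "a \<in> Field W \<Longrightarrow> bij_betw (\<lambda>x. f x k) (cl a k) {..f a k}"
proof (rule bij_betw_imageI)
  assume a: "a \<in> Field W"
  show "inj_on (\<lambda>x. f x k) (cl a k)"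
    by (rule inj_onI) (use a le_Field fam_below_eq[OF fam_all _ _ a] in \<open>unfold cl_def, blast\<close>)
  show "(\<lambda>x. f x k) ` cl a k = {..f a k}"
  proof (intro equalityI subsetI)
    fix p assume "p \<in> {..f a k}"
    then consider "p = f a k" | "p < f a k" by fastforce
    then show "p \<in> (\<lambda>x. f x k) ` cl a k"
    proof cases
      case 1
      then show ?thesis using cl_self[OF a] by blast
    next
      case 2
      then obtain b where "b \<sqsubset> a" "f b k = p" "below k (f b) (f a)"
        using node_filled[OF nodes] by blast
      then show ?thesis by (auto simp: cl_def lessW_def)
    qed
  qed (auto simp: cl_def below_le)
qed

lemma cl_inj: "x \<in> cl a k \<Longrightarrow> y \<in> cl a k \<Longrightarrow> f x k = f y k \<Longrightarrow> x = y"
  using cl_bij[OF cl_Field'] by (auto simp: bij_betw_def inj_on_def)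

lemma cl_position:
  assumes "a \<in> Field W" "p \<le> f a k"
  obtains x where "x \<in> cl a k" "f x k = p"
  using cl_bij[OF assms(1), of k] assms(2) unfolding bij_betw_def by (metis atMost_iff imageE)

lemma cl_below: 
  assumes "x \<in> cl a k" "y \<in> cl a k" "f x k \<le> f y k"
  shows "x \<in> cl y k"
proof -
  have F: "x \<in> Field W" "y \<in> Field W" using assms cl_Field by auto
  have below: "below k (f x) (f y)"
    by (rule below_cut[OF f_branch f_branch _ _ assms(3)]) (use assms in \<open>auto simp: cl_def\<close>)
  have "x \<sqsubseteq> y"
  proof (cases "f x k = f y k")
    case True
    then show ?thesis using cl_inj[OF assms(1,2)] le_refl F by simp
  next
    case False
    then show ?thesis
      using fam_below_lt[OF fam_all F below] assms(3) lt_imp_le by simp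
  qed
  then show ?thesis using below by (simp add: cl_def)
qed

lemma cl_lt_iff:
  assumes "x \<in> cl a k" "y \<in> cl a k"
  shows "x \<sqsubset> y \<longleftrightarrow> f x k < f y k"
proof
  assume lt: "x \<sqsubset> y"
  show "f x k < f y k"
  proof (rule ccontr)
    assume "\<not> ?thesis"
    then have "y \<sqsubseteq> x" using cl_below[OF assms(2,1)] by (simp add: cl_def)
    then show False using lt lt_le_trans lt_irrefl by blast
  qed
next
  assume "f x k < f y k"
  then show "x \<sqsubset> y"
    using cl_below[OF assms] by (auto simp: cl_def lessW_def)
qed

lemma cl_trans: "x \<in> cl y k \<Longrightarrow> y \<in> cl a k \<Longrightarrow> x \<in> cl a k"
  using le_trans below_trans by (auto simp: cl_def)

lemma cl_mono: "k \<le> l \<Longrightarrow> cl a k \<subseteq> cl a l"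
  using below_mono by (auto simp: cl_def)

lemma finite_cl: "a \<in> Field W \<Longrightarrow> finite (cl a k)"
  and card_cl: "a \<in> Field W \<Longrightarrow> card (cl a k) = Suc (f a k)"
  using cl_bij[of a k] bij_betw_finite bij_betw_same_card by fastforce+

lemma card_cl_top: "top_at k a \<Longrightarrow> card (cl a k) = m k"
  using card_cl[of a k] m_pos[of k] by (simp add: top_at_def)

lemma level_scheme: "level m scheme k = {cl a k | a. top_at k a}"
  unfolding level_def scheme_def using card_cl_top m_eq_iff by fastforce

text \<open>Here \<open>z\<close> is the last element of block \<open>i\<close>; its
  level-\<open>k\<close> closure is the root together with that block. These closures become the
  pieces of the decomposition.\<close>

lemma cl_top_step:
  assumes a: "a \<in> Field W" and z: "z \<in> cl a (Suc k)" "f z k = m k - 1"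
    "f z (Suc k) = f z k + i * (m k - r (Suc k))"
  shows "x \<in> cl z k \<longleftrightarrow> x \<in> cl a (Suc k) \<and>
    (f x (Suc k) < r (Suc k) \<or> r (Suc k) \<le> f x k \<and> f x (Suc k) = f x k + i * (m k - r (Suc k)))"
proof
  assume x: "x \<in> cl z k"
  then have "x \<in> cl a (Suc k)"
    using cl_mono[of k "Suc k"] cl_trans[OF _ z(1)] by auto
  moreover have "f x (Suc k) < r (Suc k)" if "f x k < r (Suc k)"
    using that lstep_root[OF f_lstep] by metis
  moreover have "f x (Suc k) = f x k + i * (m k - r (Suc k))" if "r (Suc k) \<le> f x k"
    using x that below_shift[of k "f x" "f z" k] z(3) by (auto simp: cl_def)
  ultimately show "x \<in> cl a (Suc k) \<and>
    (f x (Suc k) < r (Suc k) \<or> r (Suc k) \<le> f x k \<and> f x (Suc k) = f x k + i * (m k - r (Suc k)))"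
    by (meson not_le)
next
  assume x: "x \<in> cl a (Suc k) \<and>
    (f x (Suc k) < r (Suc k) \<or> r (Suc k) \<le> f x k \<and> f x (Suc k) = f x k + i * (m k - r (Suc k)))"
  have le: "f x k \<le> f z k"
    using f_less[of x k] z(2) by simp
  have "f x (Suc k) \<le> f z (Suc k)"
    using x le z(2,3) r_less_m[of k] by auto
  then have xz: "x \<in> cl z (Suc k)"
    using cl_below x z(1) by blast
  have "below k (f x) (f z)"
  proof (rule below_SucD)
    show "below (Suc k) (f x) (f z)" using xz by (simp add: cl_def)
    show "f x k \<le> f z k" by (rule le)
    show "f x k < r (Suc k) \<or> f x (Suc k) + f z k = f z (Suc k) + f x k"
      using x lstep_root[OF f_lstep, of x k] z(3) by auto
  qed
  then show "x \<in> cl z k" using xz by (simp add: cl_def)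
qed

lemma ex_top_block:
  assumes "top_at (Suc k) a" "i < n (Suc k)"
  obtains z where "z \<in> cl a (Suc k)" "f z k = m k - 1" "f z (Suc k) = f z k + i * (m k - r (Suc k))"
proof -
  define p where "p = m k - 1 + i * (m k - r (Suc k))"
  have step: "lstep k (m k - 1) p"
    using r_less_m[of k] assms(2) by (auto simp: lstep_def p_def)
  have "p \<le> f a (Suc k)"
    using assms block_add_le[OF assms(2)] m_pos[of k] by (simp add: top_at_def p_def)
  then obtain z where z: "z \<in> cl a (Suc k)" "f z (Suc k) = p"
    using cl_position assms(1) unfolding top_at_def by metis
  then have "f z k = m k - 1"
    using lstep_inj[OF _ step] f_lstep[of k z] f_less[of z k] m_pos[of k] by simp
  then show ?thesis using that z p_def by simp
qed

section \<open>Decompositions and the associated functions\<close>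

lemma scheme_decomposition:
  assumes top: "top_at (Suc k) a"
  shows "\<exists>Fs R. decomposition W m n r scheme k (cl a (Suc k)) Fs R"
proof -
  define M where "M = m k - r (Suc k)"
  have a: "a \<in> Field W" using top by (simp add: top_at_def)
  have "\<exists>z. \<forall>i<n (Suc k). z i \<in> cl a (Suc k) \<and> f (z i) k = m k - 1 \<and> f (z i) (Suc k) = f (z i) k + i * M"
  proof -
    have "\<exists>z. z \<in> cl a (Suc k) \<and> f z k = m k - 1 \<and> f z (Suc k) = f z k + i * M" if "i < n (Suc k)" for i
      using ex_top_block[OF top that] unfolding M_def by blast
    then show ?thesis by metis
  qed
  then obtain z where z: "\<And>i. i < n (Suc k) \<Longrightarrow>
      z i \<in> cl a (Suc k) \<and> f (z i) k = m k - 1 \<and> f (z i) (Suc k) = f (z i) k + i * M"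
    by blast
  define Fs where "Fs i = cl (z i) k" for i
  define R where "R = {x \<in> cl a (Suc k). f x (Suc k) < r (Suc k)}"
  have Fs_iff: "x \<in> Fs i \<longleftrightarrow> x \<in> cl a (Suc k) \<and>
      (f x (Suc k) < r (Suc k) \<or> r (Suc k) \<le> f x k \<and> f x (Suc k) = f x k + i * M)"
    if "i < n (Suc k)" for i x
    using cl_top_step[OF a, of "z i" k i x] z[OF that] by (simp add: Fs_def M_def)
  have "decomposition W m n r scheme k (cl a (Suc k)) Fs R"
    unfolding decomposition_def
  proof (intro conjI allI impI)
    fix i assume i: "i < n (Suc k)"
    have "top_at k (z i)" using z[OF i] cl_Field by (auto simp: top_at_def)
    then show "Fs i \<in> level m scheme k" by (auto simp: level_scheme Fs_def)
  next
    show "cl a (Suc k) = (\<Union>i<n (Suc k). Fs i)"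
    proof (intro equalityI subsetI)
      fix x assume x: "x \<in> cl a (Suc k)"
      have "\<exists>i<n (Suc k). f x (Suc k) < r (Suc k) \<or> r (Suc k) \<le> f x k \<and> f x (Suc k) = f x k + i * M"
      proof (cases "f x k < r (Suc k)")
        case True
        then show ?thesis using f_lstep[of k x] n_ge2[of k] by (intro exI[of _ 0]) (auto simp: lstep_def)
      next
        case False
        then show ?thesis using f_lstep[of k x] by (auto simp: lstep_def M_def)
      qed
      then show "x \<in> (\<Union>i<n (Suc k). Fs i)" using x Fs_iff by auto
    qed (use Fs_iff in auto)
  next
    fix i j assume ij: "i < n (Suc k)" "j < n (Suc k)" "i \<noteq> j"
    show "Fs i \<inter> Fs j = R"
      using ij Fs_iff[OF ij(1)] Fs_iff[OF ij(2)] block_unique(2)[of _ i k _ j] f_less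
      unfolding R_def M_def by fastforce
  next
    have "bij_betw (\<lambda>x. f x (Suc k)) R {..<r (Suc k)}"
    proof (rule bij_betw_imageI)
      show "inj_on (\<lambda>x. f x (Suc k)) R"
        using cl_bij[OF a, of "Suc k"] by (auto simp: R_def bij_betw_def inj_on_def)
      have "p \<in> (\<lambda>x. f x (Suc k)) ` R" if "p < r (Suc k)" for p
      proof -
        have "p \<le> f a (Suc k)"
          using that top r_less_m[of k] m_less_Suc[of k] by (simp add: top_at_def)
        then obtain x where "x \<in> cl a (Suc k)" "f x (Suc k) = p"
          using cl_position[OF a] by metis
        then show ?thesis using that by (force simp: R_def)
      qed
      then show "(\<lambda>x. f x (Suc k)) ` R = {..<r (Suc k)}"
        by (auto simp: R_def)
    qed
    then show "card R = r (Suc k)"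
      using bij_betw_same_card by fastforce
  next
    show "set_less W R (Fs 0 - R)"
      unfolding set_less_def
    proof (intro ballI)
      fix x y assume "x \<in> R" "y \<in> Fs 0 - R"
      then have "x \<in> cl a (Suc k)" "y \<in> cl a (Suc k)" "f x (Suc k) < f y (Suc k)"
        using Fs_iff[of 0 y] n_ge2[of k] by (auto simp: R_def)
      then show "x \<sqsubset> y" using cl_lt_iff by blast
    qed
  next
    fix i assume i: "Suc i < n (Suc k)"
    show "set_less W (Fs i - R) (Fs (Suc i) - R)"
      unfolding set_less_def
    proof (intro ballI)
      fix x y assume xy: "x \<in> Fs i - R" "y \<in> Fs (Suc i) - R"
      then have "x \<in> cl a (Suc k)" "y \<in> cl a (Suc k)"
        "f x (Suc k) = f x k + i * M" "f y (Suc k) = f y k + Suc i * M" "r (Suc k) \<le> f y k"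
        using i Fs_iff[of i x] Fs_iff[of "Suc i" y] by (auto simp: R_def)
      moreover have "f x k < r (Suc k) + M"
        using f_less[of x k] r_less_m[of k] by (simp add: M_def)
      ultimately have "f x (Suc k) < f y (Suc k)" by simp
      then show "x \<sqsubset> y" using cl_lt_iff \<open>x \<in> cl a (Suc k)\<close> \<open>y \<in> cl a (Suc k)\<close> by blast
    qed
  qed
  then show ?thesis by blast
qed

text \<open>\<open>Xi\<close> refers to an arbitrary decomposition, so every decomposition has to
  match the blocks of positions. Its pieces are closures of ordinals \<open>z i\<close> at the last
  position, whose block indices \<open>d i\<close> increase strictly, hence
  \<open>d i = i\<close>.\<close>

lemma decomposition_blocks:
  assumes top: "top_at (Suc k) a" and dec: "decomposition W m n r scheme k (cl a (Suc k)) Fs R"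
  shows "x \<in> R \<Longrightarrow> f x (Suc k) < r (Suc k)"
    and "i < n (Suc k) \<Longrightarrow> x \<in> Fs i - R \<Longrightarrow>
      r (Suc k) \<le> f x k \<and> f x (Suc k) = f x k + i * (m k - r (Suc k))"
proof -
  define M where "M = m k - r (Suc k)"
  have M: "M > 0" using r_less_m[of k] by (simp add: M_def)
  have a: "a \<in> Field W" using top by (simp add: top_at_def)
  have "\<exists>z. \<forall>i<n (Suc k). top_at k (z i) \<and> Fs i = cl (z i) k"
  proof -
    have "\<exists>z. top_at k z \<and> Fs i = cl z k" if "i < n (Suc k)" for i
      using dec that unfolding decomposition_def level_scheme by blast
    then show ?thesis by metis
  qed
  then obtain z where z: "\<And>i. i < n (Suc k) \<Longrightarrow> top_at k (z i) \<and> Fs i = cl (z i) k"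
    by blast
  have inter: "Fs i \<inter> Fs j = R" if "i < n (Suc k)" "j < n (Suc k)" "i \<noteq> j" for i j
    using dec that by (simp add: decomposition_def)
  have F: "cl a (Suc k) = (\<Union>i<n (Suc k). Fs i)" and card_R: "card R = r (Suc k)"
    and chain: "\<And>i. Suc i < n (Suc k) \<Longrightarrow> set_less W (Fs i - R) (Fs (Suc i) - R)"
    using dec by (auto simp: decomposition_def)
  have zF: "z i \<in> Fs i" "z i \<in> cl a (Suc k)" if "i < n (Suc k)" for i
    using z[OF that] cl_self F that by (auto simp: top_at_def)
  \<comment> \<open>A \<open>z i\<close> in the root would be the last element of another piece too;
    both pieces would then equal the root, which has fewer than \<open>m k\<close> elements.\<close>
  have zR: "z i \<notin> R" if i: "i < n (Suc k)" for i
  proof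
    assume "z i \<in> R"
    obtain j where j: "j < n (Suc k)" "i \<noteq> j"
      using n_ge2[of k] by (metis One_nat_def Suc_1 Suc_le_lessD less_trans zero_less_one zero_neq_one)
    then have "z i \<in> cl (z j) k" using \<open>z i \<in> R\<close> inter[OF i] z by auto
    moreover have "z j \<in> cl (z j) k" "f (z i) k = f (z j) k"
      using z[OF i] z[OF j(1)] cl_self by (auto simp: top_at_def)
    ultimately have "z i = z j" using cl_inj by blast
    then have "R = cl (z i) k" using inter[OF i j] z[OF i] z[OF j(1)] by auto
    then show False
      using card_R card_cl_top[of k "z i"] z[OF i] r_less_m[of k] by simp
  qed
  have "\<exists>d. \<forall>i<n (Suc k). d i < n (Suc k) \<and> f (z i) (Suc k) = f (z i) k + d i * M"
  proof -
    have "\<exists>d<n (Suc k). f (z i) (Suc k) = f (z i) k + d * M" if "i < n (Suc k)" for i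
      using f_lstep[of k "z i"] z[OF that] r_less_m[of k]
      by (auto simp: lstep_def top_at_def M_def split: if_splits)
    then show ?thesis by metis
  qed
  then obtain d where d: "\<And>i. i < n (Suc k) \<Longrightarrow> d i < n (Suc k) \<and> f (z i) (Suc k) = f (z i) k + d i * M"
    by blast
  have "d i = i" if "i < n (Suc k)" for i
  proof (rule strict_chain_id[of "n (Suc k)"])
    fix i assume i: "Suc i < n (Suc k)"
    then have "z i \<sqsubset> z (Suc i)"
      using chain[OF i] zF(1)[of i] zF(1)[of "Suc i"] zR[of i] zR[of "Suc i"] by (auto simp: set_less_def)
    then have "f (z i) (Suc k) < f (z (Suc i)) (Suc k)"
      using cl_lt_iff[OF zF(2) zF(2)] i by simp
    then show "d i < d (Suc i)"
      using d[of i] d[of "Suc i"] z[of i] z[of "Suc i"] i M by (simp add: top_at_def)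
  qed (use d that in auto)
  then have Fs_iff: "y \<in> Fs i \<longleftrightarrow> y \<in> cl a (Suc k) \<and>
      (f y (Suc k) < r (Suc k) \<or> r (Suc k) \<le> f y k \<and> f y (Suc k) = f y k + i * M)"
    if "i < n (Suc k)" for i y
    using cl_top_step[OF a zF(2)[OF that], of i y] z[OF that] d[OF that] that
    by (simp add: top_at_def M_def)
  have n: "0 < n (Suc k)" "1 < n (Suc k)" using n_ge2[of k] by auto
  have R_iff: "y \<in> R \<longleftrightarrow> y \<in> cl a (Suc k) \<and> f y (Suc k) < r (Suc k)" for y
    using inter[OF n] Fs_iff[OF n(1), of y] Fs_iff[OF n(2), of y] M by auto
  show "x \<in> R \<Longrightarrow> f x (Suc k) < r (Suc k)" using R_iff by blast
  show "i < n (Suc k) \<Longrightarrow> x \<in> Fs i - R \<Longrightarrow>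
      r (Suc k) \<le> f x k \<and> f x (Suc k) = f x k + i * (m k - r (Suc k))"
    using R_iff Fs_iff by (auto simp: M_def)
qed

text \<open>A value exists by \<open>scheme_decomposition\<close>;
  \<open>decomposition_blocks\<close> and \<open>block_unique\<close> leave only one candidate for
  the definite description.\<close>

lemma Xi_scheme:
  assumes x: "x \<in> Field W"
  shows "f x (Suc k) < r (Suc k) \<Longrightarrow> Xi W m n r scheme x (Suc k) = -1"
    and "r (Suc k) \<le> f x k \<Longrightarrow> f x (Suc k) = f x k + i * (m k - r (Suc k)) \<Longrightarrow>
      Xi W m n r scheme x (Suc k) = int i"
proof -
  define P where "P v \<longleftrightarrow> (\<exists>F\<in>level m scheme (Suc k). x \<in> F \<and>
         (\<exists>Fs R. decomposition W m n r scheme k F Fs R \<and>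
            ((x \<in> R \<and> v = -1) \<or> (\<exists>i<n (Suc k). x \<in> Fs i - R \<and> v = int i))))" for v :: int
  have Xi: "Xi W m n r scheme x (Suc k) = (THE v. P v)"
    by (simp add: Xi_def P_def)
  have P_cases: "f x (Suc k) < r (Suc k) \<and> v = -1 \<or>
      (\<exists>i. r (Suc k) \<le> f x k \<and> f x (Suc k) = f x k + i * (m k - r (Suc k)) \<and> v = int i)" if "P v" for v
  proof -
    have "\<exists>a Fs R. top_at (Suc k) a \<and> decomposition W m n r scheme k (cl a (Suc k)) Fs R \<and>
      ((x \<in> R \<and> v = -1) \<or> (\<exists>i<n (Suc k). x \<in> Fs i - R \<and> v = int i))"
      using that unfolding P_def level_scheme by blast
    then obtain a Fs R where top: "top_at (Suc k) a"
      and dec: "decomposition W m n r scheme k (cl a (Suc k)) Fs R"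
      and "(x \<in> R \<and> v = -1) \<or> (\<exists>i<n (Suc k). x \<in> Fs i - R \<and> v = int i)"
      by blast
    then show ?thesis using decomposition_blocks[OF top dec] by blast
  qed
  have "\<exists>v. P v"
  proof -
    obtain a where a: "top_at (Suc k) a" "x \<in> cl a (Suc k)" using ex_top_above[OF x] by blast
    obtain Fs R where dec: "decomposition W m n r scheme k (cl a (Suc k)) Fs R"
      using scheme_decomposition[OF a(1)] by blast
    then have "x \<in> R \<or> (\<exists>i<n (Suc k). x \<in> Fs i - R)"
      using a(2) unfolding decomposition_def by blast
    moreover have "cl a (Suc k) \<in> level m scheme (Suc k)"
      using a(1) by (auto simp: level_scheme)
    ultimately show ?thesis unfolding P_def using dec a(2) by metis
  qed
  then obtain v where v: "P v" by blast
  show "Xi W m n r scheme x (Suc k) = -1" if *: "f x (Suc k) < r (Suc k)"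
  proof -
    have "w = -1" if "P w" for w
      using P_cases[OF that] * by auto
    then show ?thesis unfolding Xi using v by (metis the_equality)
  qed
  show "Xi W m n r scheme x (Suc k) = int i"
    if *: "r (Suc k) \<le> f x k" "f x (Suc k) = f x k + i * (m k - r (Suc k))"
  proof -
    have "w = int i" if "P w" for w
      using P_cases[OF that] * block_unique(2)[of "f x k" i k "f x k"] f_less[of x k] by auto
    then show ?thesis unfolding Xi using v by (metis the_equality)
  qed
qed

text \<open>A level-\<open>j\<close> member containing both points exists iff \<open>x\<close> is in
  the level-\<open>j\<close> closure of \<open>y\<close>: one direction is
  \<open>fam_below_cut\<close>, for the other \<open>y\<close> is enlarged to a full set.
  Monotonicity of \<open>below\<close> in the level turns the least such level into an
  inequality.\<close>

lemma rho_scheme: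
  assumes "x \<sqsubseteq> y"
  shows "rho m scheme x y \<le> k \<longleftrightarrow> below k (f x) (f y)"
proof -
  have y: "y \<in> Field W" using assms le_Field by blast
  have iff: "(\<exists>F\<in>level m scheme j. {x, y} \<subseteq> F) \<longleftrightarrow> below j (f x) (f y)" for j
  proof
    assume "\<exists>F\<in>level m scheme j. {x, y} \<subseteq> F"
    then obtain z where z: "x \<in> cl z j" "y \<in> cl z j"
      unfolding level_scheme by blast
    then show "below j (f x) (f y)"
      using fam_below_cut[OF fam_all _ y assms, of z j] cl_Field' by (auto simp: cl_def)
  next
    assume b: "below j (f x) (f y)"
    obtain z where z: "top_at j z" "y \<in> cl z j" using ex_top_above[OF y] by blast
    have "x \<in> cl y j" using b assms by (simp add: cl_def)
    then have "{x, y} \<subseteq> cl z j" using z cl_trans by blast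
    then show "\<exists>F\<in>level m scheme j. {x, y} \<subseteq> F"
      using z(1) unfolding level_scheme by blast
  qed
  obtain K where "below K (f x) (f y)"
    using fam_le_below[OF fam_all y assms] by blast
  then have "below (rho m scheme x y) (f x) (f y)"
    unfolding rho_def iff by (rule LeastI)
  then show ?thesis
    using below_mono Least_le[of "\<lambda>j. below j (f x) (f y)" k] unfolding rho_def iff by blast
qed

text \<open>By \<open>rho_scheme\<close> the closure is \<open>cl a k\<close>, in which
  \<open>a\<close> has rank \<open>f a k\<close>. Hence \<open>Delta\<close> is the first level
  where two branches differ.\<close>

lemma norm_scheme: "a \<in> Field W \<Longrightarrow> norm_k W (Field W) m scheme a k = f a k"
proof -
  assume a: "a \<in> Field W"
  have "closure_k W (Field W) m scheme a k = cl a k"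
    unfolding closure_k_def cl_def using rho_scheme le_Field by blast
  then show ?thesis
    using card_cl[OF a] finite_cl[OF a] cl_self[OF a] by (simp add: norm_k_def)
qed

lemma construction_scheme_scheme: "construction_scheme W (Field W) m n r scheme"
  unfolding construction_scheme_def
proof (intro conjI ballI allI impI)
  fix F assume "F \<in> scheme"
  then obtain a k where F: "F = cl a k" "top_at k a" by (auto simp: scheme_def)
  then have a: "a \<in> Field W" by (simp add: top_at_def)
  show "finite F" "F \<noteq> {}" "F \<subseteq> Field W" "\<exists>k. card F = m k"
    using F finite_cl[OF a] cl_self[OF a, of k] cl_Field card_cl_top by blast+
next
  fix A assume A: "finite A \<and> A \<subseteq> Field W"
  have "\<exists>z k. top_at k z \<and> A \<subseteq> cl z k"
    using A[THEN conjunct1] A[THEN conjunct2]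
  proof (induction rule: finite_induct)
    case empty
    have "Field W \<noteq> {}" using W by (auto simp: omega1_order_def)
    then show ?case using ex_top_above by blast
  next
    case (insert x A)
    then obtain z k where z: "top_at k z" "A \<subseteq> cl z k" by blast
    have zF: "z \<in> Field W" "x \<in> Field W" using z insert by (auto simp: top_at_def)
    obtain w where w: "w \<in> Field W" "z \<sqsubseteq> w" "x \<sqsubseteq> w"
      using le_total[OF zF] le_refl zF lt_imp_le by blast
    obtain K1 where K1: "\<And>k. k \<ge> K1 \<Longrightarrow> below k (f z) (f w)" using fam_le_below[OF fam_all w(1,2)] by blast
    obtain K2 where K2: "\<And>k. k \<ge> K2 \<Longrightarrow> below k (f x) (f w)" using fam_le_below[OF fam_all w(1,3)] by blast
    define l where "l = max k (max K1 K2)"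
    have "z \<in> cl w l" "x \<in> cl w l"
      using K1[of l] K2[of l] w by (auto simp: cl_def l_def)
    moreover have "A \<subseteq> cl z l"
      using z(2) cl_mono[of k l z] by (auto simp: l_def)
    moreover obtain v where "top_at l v" "w \<in> cl v l" using ex_top_above[OF w(1)] by blast
    ultimately show ?case
      using cl_trans by (intro exI[of _ v] exI[of _ l]) blast
  qed
  then show "\<exists>F\<in>scheme. A \<subseteq> F" by (auto simp: scheme_def)
next
  have init: "initial_segment W (cl a k \<inter> cl b k) (cl a k)" for a b k
    unfolding initial_segment_def
  proof (intro conjI ballI impI)
    fix x y assume xy: "x \<in> cl a k \<inter> cl b k" "y \<in> cl a k" "y \<sqsubset> x"
    then have "y \<in> cl x k"
      using cl_lt_iff[of y a k x] cl_below[of y a k x] by simp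
    then show "y \<in> cl a k \<inter> cl b k" using xy cl_trans by blast
  qed blast
  fix k E F assume "E \<in> level m scheme k" "F \<in> level m scheme k"
  then obtain a b where "E = cl a k" "F = cl b k" by (auto simp: level_scheme)
  then show "initial_segment W (E \<inter> F) E" "initial_segment W (E \<inter> F) F"
    using init[of a k b] init[of b k a] by (auto simp: Int_commute)
next
  fix k F assume "F \<in> level m scheme (Suc k)"
  then show "\<exists>Fs R. decomposition W m n r scheme k F Fs R"
    using scheme_decomposition by (auto simp: level_scheme)
qed

end

section \<open>Splitting nodes\<close>

context scheme_order
begin

section \<open>Limit ordinals and finite sets of ordinals\<close>

lemma ex_limit:
  assumes "\<mu> \<in> Field W"
  obtains \<kappa> where "limit \<kappa>" "\<mu> \<sqsubset> \<kappa>"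
proof -
  define I where "I x = {y. \<mu> \<sqsubset> y \<and> y \<sqsubset> x}" for x
  \<comment> \<open>If all these intervals were finite, their cardinalities would inject the
    ordinals after \<open>\<mu>\<close> into the natural numbers.\<close>
  have "\<exists>x. infinite (I x)"
  proof (rule ccontr)
    assume "\<not> ?thesis"
    then have fin: "finite (I x)" for x by blast
    have less: "card (I x) < card (I y)" if "\<mu> \<sqsubset> x" "x \<sqsubset> y" for x y
    proof (rule psubset_card_mono[OF fin])
      have "x \<in> I y" "x \<notin> I x" using that by (auto simp: I_def)
      moreover have "I x \<subseteq> I y" using that lt_trans by (auto simp: I_def)
      ultimately show "I x \<subset> I y" by blast
    qed
    have "inj_on (\<lambda>x. card (I x)) {x. \<mu> \<sqsubset> x}"
    proof (rule inj_onI)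
      fix x y assume xy: "x \<in> {x. \<mu> \<sqsubset> x}" "y \<in> {x. \<mu> \<sqsubset> x}" "card (I x) = card (I y)"
      then have "\<not> x \<sqsubset> y" "\<not> y \<sqsubset> x" using less[of x y] less[of y x] by auto
      then show "x = y" using xy le_total[of x y] le_iff lt_Field by blast
    qed
    then have "countable {x. \<mu> \<sqsubset> x}" by (rule countableI')
    then have "countable ({x. x \<sqsubseteq> \<mu>} \<union> {x. \<mu> \<sqsubset> x})" using countable_le by simp
    moreover have "Field W \<subseteq> {x. x \<sqsubseteq> \<mu>} \<union> {x. \<mu> \<sqsubset> x}" using le_total[OF _ assms] by blast
    ultimately have "countable (Field W)" using countable_subset by blast
    then show False using W by (simp add: omega1_order_def)
  qed
  \<comment> \<open>The least ordinal with an infinite interval has no immediate predecessor,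
    because one more point cannot make a finite interval infinite.\<close>
  then obtain \<kappa> where inf: "infinite (I \<kappa>)" and least: "\<And>z. z \<sqsubset> \<kappa> \<Longrightarrow> finite (I z)"
    using ex_least[of "\<lambda>x. infinite (I x)"] by auto
  then obtain y where "y \<in> I \<kappa>" by (metis finite.emptyI ex_in_conv)
  then have \<mu>: "\<mu> \<sqsubset> \<kappa>" using lt_trans by (auto simp: I_def)
  have "\<exists>c. b \<sqsubset> c \<and> c \<sqsubset> \<kappa>" if b: "b \<sqsubset> \<kappa>" for b
  proof (rule ccontr)
    assume "\<not> ?thesis"
    then have "c = b \<or> c \<sqsubset> b" if "c \<sqsubset> \<kappa>" for c
      using that b le_total[of c b] le_iff[of b c] lt_Field by blast
    then have "I \<kappa> \<subseteq> insert b (I b)" by (auto simp: I_def)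
    then show False using inf least[OF b] finite_subset by blast
  qed
  then have "limit \<kappa>" using \<mu> by (auto simp: limit_def)
  then show ?thesis using that \<mu> by blast
qed

lemma ex_max:
  assumes "finite D" "D \<noteq> {}" "D \<subseteq> Field W"
  shows "\<exists>x\<in>D. \<forall>y\<in>D. y \<sqsubseteq> x"
  using assms
proof (induction rule: finite_ne_induct)
  case (insert x D)
  then obtain z where z: "z \<in> D" "\<forall>y\<in>D. y \<sqsubseteq> z" by auto
  show ?case
    using le_total[of x z] insert.prems z le_trans le_refl lt_imp_le by (metis insert_iff subset_iff)
qed (auto simp: le_refl)

lemma ex_min:
  assumes "D \<noteq> {}" "D \<subseteq> Field W"
  shows "\<exists>x\<in>D. \<forall>y\<in>D. x \<sqsubseteq> y"
proof -
  obtain x where "x \<in> D" "\<And>z. z \<sqsubset> x \<Longrightarrow> z \<notin> D"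
    using ex_least[of "\<lambda>x. x \<in> D"] assms(1) by blast
  then show ?thesis using assms(2) le_total by blast
qed

lemma enum_rank:
  assumes D: "finite D" "D \<subseteq> Field W" and a: "a < card D"
  shows "enum W D a \<in> D" "card {y \<in> D. y \<sqsubset> enum W D a} = a"
proof -
  define rk where "rk x = card {y \<in> D. y \<sqsubset> x}" for x
  have less: "rk x < rk y" if "x \<in> D" "x \<sqsubset> y" for x y
    unfolding rk_def
  proof (rule psubset_card_mono)
    show "{z \<in> D. z \<sqsubset> x} \<subset> {z \<in> D. z \<sqsubset> y}"
      using that lt_trans by (auto simp: psubset_eq) (metis (lifting) lt_irrefl mem_Collect_eq)
  qed (use D in auto)
  have inj: "inj_on rk D"
  proof (rule inj_onI)
    fix x y assume xy: "x \<in> D" "y \<in> D" "rk x = rk y"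
    then have "\<not> x \<sqsubset> y" "\<not> y \<sqsubset> x" using less[of x y] less[of y x] by auto
    then show "x = y" using xy D le_total[of x y] le_iff by blast
  qed
  have "rk x < card D" if "x \<in> D" for x
    unfolding rk_def
  proof (rule psubset_card_mono[OF D(1)])
    have "x \<notin> {y \<in> D. y \<sqsubset> x}" by simp
    then show "{y \<in> D. y \<sqsubset> x} \<subset> D" using that by blast
  qed
  then have "rk ` D \<subseteq> {..<card D}" by auto
  then have "rk ` D = {..<card D}"
    using card_image[OF inj] by (simp add: card_subset_eq)
  then obtain x where x: "x \<in> D" "rk x = a" using a by (metis imageE lessThan_iff)
  have "enum W D a = x"
    unfolding enum_def
    by (rule the_equality) (use x inj in \<open>auto simp: rk_def inj_on_def\<close>)
  then show "enum W D a \<in> D" "card {y \<in> D. y \<sqsubset> enum W D a} = a"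
    using x by (auto simp: rk_def)
qed

end

context scheme_type
begin

text \<open>Splices a branch up to \<open>j1\<close> with one plus another path from
  \<open>j1\<close> on. It replaces the true continuation of an ordinal by one pulled back from a
  predecessor.\<close>

lemma path_join:
  assumes "branch x" "\<And>j. j1 \<le> j \<Longrightarrow> j < l \<Longrightarrow> lstep j (g j) (g (Suc j))" "x j1 = Suc (g j1)"
    and "j < l"
  shows "lstep j (if j \<le> j1 then x j else Suc (g j)) (if Suc j \<le> j1 then x (Suc j) else Suc (g (Suc j)))"
proof -
  consider "Suc j \<le> j1" | "j = j1" | "j > j1" by linarith
  then show ?thesis
  proof cases
    case 1
    then show ?thesis using branch_lstep[OF assms(1)] by simp
  next
    case 2
    then show ?thesis using assms(2-4) lstep_Suc by simp
  next
    case 3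
    then show ?thesis using assms(2,4) lstep_Suc by simp
  qed
qed

lemma path_less:
  assumes "\<And>j. k \<le> j \<Longrightarrow> j < l \<Longrightarrow> lstep j (g j) (g (Suc j))" "g k < m k" "k \<le> j" "j \<le> l"
  shows "g j < m j"
  using assms(3,4)
proof (induction rule: dec_induct)
  case (step j)
  then show ?case using assms(1)[of j] lstep_less by simp
qed (use assms in auto)

lemma path_unique_down:
  assumes path: "\<And>j. k \<le> j \<Longrightarrow> j < l \<Longrightarrow> lstep j (g j) (g (Suc j))" and "g k < m k"
    and "branch x" "x l = g l" "k \<le> j" "j \<le> l"
  shows "x j = g j"
  using assms(6,5)
proof (induction rule: inc_induct)
  case (step i)
  then have "lstep i (x i) (g (Suc i))" "lstep i (g i) (g (Suc i))"
    using branch_lstep[OF assms(3), of i] path[of i] by auto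
  moreover have "g i < m i" using path_less[OF path assms(2)] step by simp
  ultimately show ?case
    using lstep_inj branch_less[OF assms(3)] by blast
qed (use assms in auto)

end

context scheme_tower
begin

text \<open>Genericity allows a descent from \<open>d\<close> to earlier ordinals, each raising the
  offset by 1, until a limit is met; the limit \<open>\<kappa>\<close> bounds the descent from
  below. There the first position outside the root splits into all blocks inside \<open>E e\<close>.
  The path \<open>g\<close> starts at the position of \<open>d\<close> but need not be the one that
  \<open>d\<close> follows.\<close>

lemma capture_base:
  assumes lam: "limit \<kappa>" "e \<sqsubset> \<kappa>" "\<beta> \<sqsubset> \<kappa>" and "\<kappa> \<sqsubseteq> d" "\<forall>j\<ge>j0. (j, f d j + c) \<in> E e"
  shows "\<exists>l g. k \<le> l \<and> g k = f d k \<and> (\<forall>j. k \<le> j \<and> j < l \<longrightarrow> lstep j (g j) (g (Suc j))) \<and>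
    r (Suc l) \<le> g l \<and> f \<beta> l < r (Suc l) \<and>
    (\<forall>i<n (Suc l). (Suc l, g l + c + i * (m l - r (Suc l))) \<in> E e)"
  using assms(4,5)
proof (induction d arbitrary: c j0 k rule: wf_induct_rule[OF wf_lt])
  case (1 d)
  have dF: "d \<in> Field W" using 1(2) le_Field by blast
  have ed: "e \<sqsubset> d" and bd: "\<beta> \<sqsubset> d" using lam 1(2) lt_le_trans by auto
  obtain K where K: "\<And>k. k \<ge> K \<Longrightarrow> below k (f \<beta>) (f d)"
    using fam_le_below[OF fam_all dF lt_imp_le[OF bd]] by blast
  show ?case
  proof (cases "limit d")
    case True
    obtain b j1 where b: "b \<sqsubset> d" "\<beta> \<sqsubseteq> b" "max k K \<le> j1" "f d j1 = Suc (f b j1)" "below j1 (f b) (f d)"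
      and split: "limit d \<longrightarrow> (\<forall>l\<ge>j1. r (Suc l) = Suc (f b l) \<longrightarrow>
         (\<forall>i<n (Suc l). (Suc l, Suc (f b l) + c + i * (m l - r (Suc l))) \<in> E e))"
      using node_generic[OF nodes ed 1(3) bd, of "max k K"] by (elim exE conjE) (rule that)
    \<comment> \<open>The root at level \<open>Suc l\<close> ends just before position
      \<open>Suc (f b l)\<close>, and \<open>\<beta>\<close>, being at or before \<open>b\<close>,
      has a position inside it.\<close>
    obtain l where l: "l > j1" "r (Suc l) = Suc (f b l)"
      using node_root[OF nodes[of b], of j1 0] by auto
    define g where "g j = (if j \<le> j1 then f d j else Suc (f b j))" for j
    have gl: "g l = Suc (f b l)" using l by (simp add: g_def)
    have "below j1 (f \<beta>) (f b)"
      using fam_below_cut[OF fam_all dF _ b(2) K b(5)] b(1,3) lt_Field by auto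
    then have "f \<beta> l \<le> f b l" using below_le l(1) by simp
    moreover have "lstep j (g j) (g (Suc j))" if "k \<le> j \<and> j < l" for j
      unfolding g_def using path_join[OF f_branch[of d], of j1 l "f b" j] f_lstep b(4) that by blast
    ultimately show ?thesis
      using l b(3) gl split[rule_format, OF True _ l(2)] by (intro exI[of _ l] exI[of _ g]) (auto simp: g_def)
  next
    case False
    then have "\<kappa> \<sqsubset> d" using lam(1) 1(2) by (auto simp: lessW_def)
    obtain b j1 where b: "b \<sqsubset> d" "\<kappa> \<sqsubseteq> b" "k \<le> j1" "f d j1 = Suc (f b j1)"
      and T: "\<forall>j\<ge>j1. (j, Suc (f b j) + c) \<in> E e"
      using node_generic[OF nodes ed 1(3) \<open>\<kappa> \<sqsubset> d\<close>, of k] by (elim exE conjE) (rule that)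
    \<comment> \<open>The new \<open>b\<close> is still at or after \<open>\<kappa>\<close>, so the
      induction hypothesis applies to it; the 1 between \<open>d\<close> and \<open>b\<close> goes
      into the offset.\<close>
    have "\<exists>l g. j1 \<le> l \<and> g j1 = f b j1 \<and> (\<forall>j. j1 \<le> j \<and> j < l \<longrightarrow> lstep j (g j) (g (Suc j))) \<and>
      r (Suc l) \<le> g l \<and> f \<beta> l < r (Suc l) \<and>
      (\<forall>i<n (Suc l). (Suc l, g l + Suc c + i * (m l - r (Suc l))) \<in> E e)"
      by (rule 1(1)) (use b T in auto)
    then obtain l g where g: "j1 \<le> l" "g j1 = f b j1" "\<And>j. j1 \<le> j \<Longrightarrow> j < l \<Longrightarrow> lstep j (g j) (g (Suc j))"
      "r (Suc l) \<le> g l" "f \<beta> l < r (Suc l)"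
      "\<And>i. i < n (Suc l) \<Longrightarrow> (Suc l, g l + Suc c + i * (m l - r (Suc l))) \<in> E e"
      by blast
    define g' where "g' j = (if j \<le> j1 then f d j else Suc (g j))" for j
    have gl: "g' l = Suc (g l)" using g(1,2) b(4) by (simp add: g'_def)
    have "lstep j (g' j) (g' (Suc j))" if "k \<le> j \<and> j < l" for j
      unfolding g'_def using path_join[OF f_branch[of d], of j1 l g j] g(2,3) b(4) that by simp
    then show ?thesis
      using g b(3) gl by (intro exI[of _ l] exI[of _ g']) (auto simp: g'_def)
  qed
qed

text \<open>Descends from \<open>\<alpha>\<close> to \<open>d\<close> and continues by
  \<open>capture_base\<close>; \<open>h\<close> is the trace that \<open>d\<close> would have along
  \<open>g\<close>. With \<open>\<beta>\<close> the last root point and \<open>d\<close> the first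
  point of a tail, the root at level \<open>Suc l\<close> separates the two, as capturing
  requires.\<close>

lemma capture_path:
  assumes lam: "limit \<kappa>" "e \<sqsubset> \<kappa>" "\<beta> \<sqsubset> \<kappa>" "\<kappa> \<sqsubseteq> d"
    and "d \<sqsubseteq> \<alpha>" "below k (f d) (f \<alpha>)" "\<forall>j\<ge>j0. (j, f \<alpha> j + c) \<in> E e"
  shows "\<exists>l g h. k \<le> l \<and> g k = f \<alpha> k \<and> h k = f d k \<and>
    (\<forall>j. k \<le> j \<and> j < l \<longrightarrow> lstep j (g j) (g (Suc j)) \<and>
       (if h j < r (Suc j) then h (Suc j) = h j else h (Suc j) + g j = g (Suc j) + h j)) \<and>
    r (Suc l) \<le> g l \<and> r (Suc l) \<le> h l \<and> f \<beta> l < r (Suc l) \<and>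
    (\<forall>i<n (Suc l). (Suc l, g l + c + i * (m l - r (Suc l))) \<in> E e)"
  using assms(5-7)
proof (induction \<alpha> arbitrary: c j0 k rule: wf_induct_rule[OF wf_lt])
  case (1 \<alpha>)
  have aF: "\<alpha> \<in> Field W" and dF: "d \<in> Field W" using 1(2) le_Field by blast+
  show ?case
  proof (cases "d = \<alpha>")
    case True
    have "\<exists>l g. k \<le> l \<and> g k = f d k \<and> (\<forall>j. k \<le> j \<and> j < l \<longrightarrow> lstep j (g j) (g (Suc j))) \<and>
      r (Suc l) \<le> g l \<and> f \<beta> l < r (Suc l) \<and>
      (\<forall>i<n (Suc l). (Suc l, g l + c + i * (m l - r (Suc l))) \<in> E e)"
      by (rule capture_base[OF lam]) (use 1(4) True in auto)
    then obtain l g where g: "k \<le> l" "g k = f d k" "\<forall>j. k \<le> j \<and> j < l \<longrightarrow> lstep j (g j) (g (Suc j))"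
      "r (Suc l) \<le> g l" "f \<beta> l < r (Suc l)"
      "\<forall>i<n (Suc l). (Suc l, g l + c + i * (m l - r (Suc l))) \<in> E e"
      by blast
    have "(if g j < r (Suc j) then g (Suc j) = g j else g (Suc j) + g j = g (Suc j) + g j)"
      if "k \<le> j \<and> j < l" for j
      using g(3) that lstep_root[of j "g j" "g (Suc j)"] by simp
    then show ?thesis using g True by (intro exI[of _ l] exI[of _ g] conjI allI impI) auto
  next
    case False
    then have da: "d \<sqsubset> \<alpha>" using 1(2) by (simp add: lessW_def)
    have ea: "e \<sqsubset> \<alpha>" using lam(2,4) da lt_le_trans lt_trans by blast
    obtain b j1 where b: "b \<sqsubset> \<alpha>" "d \<sqsubseteq> b" "k \<le> j1" "f \<alpha> j1 = Suc (f b j1)" "below j1 (f b) (f \<alpha>)"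
      and T: "\<forall>j\<ge>j1. (j, Suc (f b j) + c) \<in> E e"
      using node_generic[OF nodes ea 1(4) da, of k] by (elim exE conjE) (rule that)
    have db: "below j1 (f d) (f b)"
      using fam_below_cut[OF fam_all aF _ b(2) below_mono[OF 1(3) b(3)] b(5)] b(1) lt_Field by auto
    have "\<exists>l g h. j1 \<le> l \<and> g j1 = f b j1 \<and> h j1 = f d j1 \<and>
      (\<forall>j. j1 \<le> j \<and> j < l \<longrightarrow> lstep j (g j) (g (Suc j)) \<and>
         (if h j < r (Suc j) then h (Suc j) = h j else h (Suc j) + g j = g (Suc j) + h j)) \<and>
      r (Suc l) \<le> g l \<and> r (Suc l) \<le> h l \<and> f \<beta> l < r (Suc l) \<and>
      (\<forall>i<n (Suc l). (Suc l, g l + Suc c + i * (m l - r (Suc l))) \<in> E e)"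
      by (rule 1(1)) (use b T db in auto)
    then obtain l g h where g: "j1 \<le> l" "g j1 = f b j1" "h j1 = f d j1"
      "\<And>j. j1 \<le> j \<Longrightarrow> j < l \<Longrightarrow> lstep j (g j) (g (Suc j))"
      "\<And>j. j1 \<le> j \<Longrightarrow> j < l \<Longrightarrow>
        (if h j < r (Suc j) then h (Suc j) = h j else h (Suc j) + g j = g (Suc j) + h j)"
      "r (Suc l) \<le> g l" "r (Suc l) \<le> h l" "f \<beta> l < r (Suc l)"
      "\<And>i. i < n (Suc l) \<Longrightarrow> (Suc l, g l + Suc c + i * (m l - r (Suc l))) \<in> E e"
      by blast
    define g' where "g' j = (if j \<le> j1 then f \<alpha> j else Suc (g j))" for j
    define h' where "h' j = (if j \<le> j1 then f d j else h j)" for j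
    have g'_ge: "g' j = Suc (g j)" and h'_ge: "h' j = h j" if "j \<ge> j1" for j
      using that g(2,3) b(4) by (auto simp: g'_def h'_def)
    have "lstep j (g' j) (g' (Suc j)) \<and>
       (if h' j < r (Suc j) then h' (Suc j) = h' j else h' (Suc j) + g' j = g' (Suc j) + h' j)"
      if j: "k \<le> j \<and> j < l" for j
    proof
      show "lstep j (g' j) (g' (Suc j))"
        unfolding g'_def using path_join[OF f_branch[of \<alpha>], of j1 l g j] g(2,4) b(4) j by simp
      show "if h' j < r (Suc j) then h' (Suc j) = h' j else h' (Suc j) + g' j = g' (Suc j) + h' j"
      proof (cases "j < j1")
        case True
        then have "h' j = f d j" "h' (Suc j) = f d (Suc j)" "g' j = f \<alpha> j" "g' (Suc j) = f \<alpha> (Suc j)"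
          by (auto simp: g'_def h'_def)
        then show ?thesis
          using below_shift[OF 1(3), of j] lstep_root[OF f_lstep[of j d]] j by auto
      next
        case False
        then show ?thesis
          using g(5)[of j] g'_ge[of j] g'_ge[of "Suc j"] h'_ge[of j] h'_ge[of "Suc j"] j
          by (auto split: if_splits)
      qed
    qed
    moreover have "k \<le> l" "g' k = f \<alpha> k" "h' k = f d k"
      using g(1) b(3) by (auto simp: g'_def h'_def)
    moreover have "r (Suc l) \<le> g' l" "r (Suc l) \<le> h' l"
      "\<forall>i<n (Suc l). (Suc l, g' l + c + i * (m l - r (Suc l))) \<in> E e"
      using g(6,7,9) g'_ge[OF g(1)] h'_ge[OF g(1)] by auto
    ultimately show ?thesis
      using g(8) by blast
  qed
qed

end

text \<open>By comparability of cardinals there is an injection one way or the other. If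
  \<open>Field W\<close> embeds in the reals, CH applies to its uncountable image; if the reals
  embed in \<open>Field W\<close>, the injection is inverted. Either way \<open>Field W\<close> maps
  onto the reals, and so onto the subsets of \<open>nat \<times> nat\<close>.\<close>

lemma CH_enumeration:
  fixes W :: "'a rel"
  assumes CH "\<not> countable (Field W)"
  obtains E :: "'a \<Rightarrow> (nat \<times> nat) set" where "\<And>T. \<exists>e\<in>Field W. E e = T"
proof -
  have "\<exists>g. g ` Field W = (UNIV :: real set)"
  proof -
    consider (1) h where "inj_on h (Field W)" "h ` Field W \<subseteq> (UNIV :: real set)"
      | (2) h where "inj_on h (UNIV :: real set)" "h ` UNIV \<subseteq> Field W"
      using ordLeq_total[OF card_of_Well_order[of "Field W"] card_of_Well_order[of "UNIV :: real set"]]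
        card_of_ordLeq[of "Field W" "UNIV :: real set"] card_of_ordLeq[of "UNIV :: real set" "Field W"]
      by metis
    then show ?thesis
    proof cases
      case 1
      then have "\<not> countable (h ` Field W)"
        using assms(2) countable_image_inj_on by blast
      then obtain \<phi> where "bij_betw \<phi> (h ` Field W) (UNIV :: real set)"
        using assms(1) unfolding CH_def by blast
      then have "(\<phi> \<circ> h) ` Field W = UNIV"
        by (simp add: bij_betw_def image_comp)
      then show ?thesis by blast
    next
      case 2
      have "inv_into UNIV h ` Field W = UNIV"
      proof (intro equalityI subsetI UNIV_I)
        fix x :: real
        have "inv_into UNIV h (h x) = x" using 2(1) by simp
        then show "x \<in> inv_into UNIV h ` Field W" using 2(2) by (metis imageI rangeI subsetD)
      qed
      then show ?thesis by blast
    qed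
  qed
  then obtain g where g: "g ` Field W = (UNIV :: real set)" by blast
  obtain \<psi> where \<psi>: "bij_betw \<psi> (UNIV :: real set) (UNIV :: nat set set)"
    using nat_sets_eqpoll_reals eqpoll_sym unfolding eqpoll_def by blast
  show ?thesis
  proof (rule that[of "\<lambda>a. prod_decode ` \<psi> (g a)"])
    fix T :: "(nat \<times> nat) set"
    obtain x where x: "\<psi> x = prod_encode ` T" using \<psi> by (metis bij_betw_imp_surj_on rangeE UNIV_I)
    obtain a where "a \<in> Field W" "g a = x" using g by (metis UNIV_I imageE)
    then show "\<exists>a\<in>Field W. prod_decode ` \<psi> (g a) = T"
      using x by (intro bexI[of _ a]) (auto simp: image_image)
  qed
qed

section \<open>Capturing\<close>

lemma uncountable_fiber:
  assumes "\<not> countable S" "countable (g ` S)"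
  obtains y where "\<not> countable {x \<in> S. g x = y}"
proof -
  have "S = (\<Union>y\<in>g ` S. {x \<in> S. g x = y})" by auto
  then have "\<exists>y. \<not> countable {x \<in> S. g x = y}"
    using assms countable_UN[of "g ` S" "\<lambda>y. {x \<in> S. g x = y}"] by metis
  then show ?thesis using that by blast
qed

context scheme_tower
begin

text \<open>Each of the finitely many elements is eventually below the largest one.\<close>

lemma common_closure_level:
  assumes "finite D" "D \<noteq> {}" "D \<subseteq> Field W"
  shows "\<exists>x k. x \<in> D \<and> J \<le> k \<and> D \<subseteq> cl x k"
proof -
  obtain x where x: "x \<in> D" "\<forall>y\<in>D. y \<sqsubseteq> x" using ex_max[OF assms] by blast
  have "\<forall>\<^sub>F k in sequentially. below k (f y) (f x)" if "y \<in> D" for y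
  proof -
    have "x \<in> Field W" "y \<sqsubseteq> x" using x that assms(3) by auto
    then obtain K where "\<And>k. k \<ge> K \<Longrightarrow> below k (f y) (f x)"
      using fam_le_below[OF fam_all] by blast
    then show ?thesis by (auto simp: eventually_sequentially)
  qed
  then have "\<forall>\<^sub>F k in sequentially. \<forall>y\<in>D. below k (f y) (f x)"
    using assms(1) by (intro eventually_ball_finite) auto
  then obtain K where K: "\<And>k. k \<ge> K \<Longrightarrow> \<forall>y\<in>D. below k (f y) (f x)"
    by (auto simp: eventually_sequentially)
  have "D \<subseteq> cl x (max J K)"
    using K[of "max J K"] x(2) by (auto simp: cl_def)
  then show ?thesis using x(1) by (intro exI[of _ x] exI[of _ "max J K"]) auto
qed

lemma inj_on_cl: "D \<subseteq> cl x k \<Longrightarrow> inj_on (\<lambda>y. f y k) D"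
  by (rule inj_onI) (use cl_inj in blast)

text \<open>Inside one closure positions increase with the order, so the \<open>a\<close>-th element
  carries the \<open>a\<close>-th member of \<open>V\<close>.\<close>

lemma same_rank_same_label:
  assumes D: "finite D" "D \<subseteq> cl x k" "(\<lambda>y. f y k) ` D = V"
    and D': "finite D'" "D' \<subseteq> cl x' k" "(\<lambda>y. f y k) ` D' = V" and a: "a < card V"
  shows "f (enum W D a) k = f (enum W D' a) k"
proof -
  have rank: "f (enum W D a) k \<in> V \<and> card {v \<in> V. v < f (enum W D a) k} = a"
    if D: "finite D" "D \<subseteq> cl x k" "(\<lambda>y. f y k) ` D = V" for D x
  proof -
    have inj: "inj_on (\<lambda>y. f y k) D"
      by (rule inj_on_cl[OF D(2)])
    then have "card D = card V" using D(3) card_image by metis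
    then have e: "enum W D a \<in> D" "card {y \<in> D. y \<sqsubset> enum W D a} = a"
      using enum_rank[OF D(1), of a] D(2) cl_Field a by auto
    have "(\<lambda>y. f y k) ` {y \<in> D. y \<sqsubset> enum W D a} = {v \<in> V. v < f (enum W D a) k}"
      using e(1) D(2,3) cl_lt_iff[of _ x k "enum W D a"] by (auto simp: image_iff subset_iff)
    moreover have "inj_on (\<lambda>y. f y k) {y \<in> D. y \<sqsubset> enum W D a}"
      using inj by (rule inj_on_subset) auto
    ultimately have "card {v \<in> V. v < f (enum W D a) k} = a"
      using card_image[of "\<lambda>y. f y k" "{y \<in> D. y \<sqsubset> enum W D a}"] e(2) by simp
    then show ?thesis using e(1) D(3) by auto
  qed
  have "finite V" using D by auto
  have strict: "card {v \<in> V. v < p} < card {v \<in> V. v < q}" if "p \<in> V" "p < q" for p q :: nat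
    using that \<open>finite V\<close> by (intro psubset_card_mono) auto
  show ?thesis
    using rank[OF D] rank[OF D'] strict by (metis less_irrefl linorder_neqE_nat)
qed

text \<open>Replaces the Delta-system lemma: the tails \<open>D - R\<close> are unbounded because the common initial
  part \<open>R\<close> is chosen of the largest possible size.\<close>

lemma thin_out:
  assumes S: "S \<subseteq> {A. finite A \<and> A \<noteq> {} \<and> A \<subseteq> Field W}" "\<not> countable S"
  shows "\<exists>S' k V R top low. S' \<subseteq> S \<and> \<not> countable S' \<and> J \<le> k \<and>
    (\<forall>D\<in>S'. top D \<in> D \<and> D \<subseteq> cl (top D) k \<and> (\<lambda>x. f x k) ` D = V) \<and>
    (\<forall>D\<in>S'. initial_segment W R D) \<and>
    (\<forall>D\<in>S'. low D \<in> D - R \<and> (\<forall>x\<in>D - R. low D \<sqsubseteq> x)) \<and>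
    (\<forall>\<mu>. countable {D \<in> S'. low D \<sqsubseteq> \<mu>})"
proof -
  have "\<exists>top k. \<forall>D\<in>S. top D \<in> D \<and> J \<le> k D \<and> D \<subseteq> cl (top D) (k D)"
  proof -
    have "\<exists>p. fst p \<in> D \<and> J \<le> snd p \<and> D \<subseteq> cl (fst p) (snd p)" if "D \<in> S" for D
      using common_closure_level[of D J] S(1) that by auto
    then obtain p where "\<forall>D\<in>S. fst (p D) \<in> D \<and> J \<le> snd (p D) \<and> D \<subseteq> cl (fst (p D)) (snd (p D))"
      by metis
    then show ?thesis by (intro exI[of _ "\<lambda>D. fst (p D)"] exI[of _ "\<lambda>D. snd (p D)"])
  qed
  then obtain top kk where top: "\<And>D. D \<in> S \<Longrightarrow> top D \<in> D \<and> J \<le> kk D \<and> D \<subseteq> cl (top D) (kk D)"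
    by blast
  \<comment> \<open>There are only countably many pairs of a level and a finite set of positions, so
    uncountably many members share one.\<close>
  define key where "key D = (kk D, (\<lambda>x. f x (kk D)) ` D)" for D
  have "key ` S \<subseteq> UNIV \<times> {V. finite V}"
    using S(1) by (auto simp: key_def)
  moreover have "countable ((UNIV :: nat set) \<times> {V :: nat set. finite V})"
    by (intro countable_SIGMA countable_Collect_finite) auto
  ultimately have "countable (key ` S)" using countable_subset by blast
  then obtain kV where unc: "\<not> countable {D \<in> S. key D = kV}"
    using uncountable_fiber[OF S(2)] by blast
  obtain k V where kV: "kV = (k, V)" by (cases kV)
  define S1 where "S1 = {D \<in> S. key D = kV}"
  have S1: "D \<in> S" "top D \<in> D" "D \<subseteq> cl (top D) k" "(\<lambda>x. f x k) ` D = V" "J \<le> k" "finite D"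
    if "D \<in> S1" for D
    using that top[of D] S(1) by (auto simp: S1_def key_def kV)
  have card_S1: "card D = card V" if "D \<in> S1" for D
  proof -
    have "inj_on (\<lambda>x. f x k) D" by (rule inj_on_cl[OF S1(3)[OF that]])
    then show ?thesis using S1(4)[OF that] card_image by metis
  qed
  define Q where "Q c \<longleftrightarrow> (\<exists>S' R. S' \<subseteq> S1 \<and> \<not> countable S' \<and> (\<forall>D\<in>S'. initial_segment W R D) \<and> card R = c)" for c
  have "Q 0"
    unfolding Q_def using unc
    by (intro exI[of _ S1] exI[of _ "{}"]) (auto simp: S1_def initial_segment_def)
  moreover have bound: "c \<le> card V" if Qc: "Q c" for c
  proof -
    obtain S' R where S': "S' \<subseteq> S1" "\<not> countable S'" "\<forall>D\<in>S'. initial_segment W R D" "card R = c"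
      using Qc unfolding Q_def by blast
    then obtain D where D: "D \<in> S'" by (metis countable_empty ex_in_conv)
    then have "R \<subseteq> D" using S'(3) by (auto simp: initial_segment_def)
    moreover have "D \<in> S1" using S'(1) D by blast
    ultimately show ?thesis using S'(4) card_S1 S1(6) card_mono by metis
  qed
  ultimately obtain c where c: "Q c" "\<And>c'. Q c' \<Longrightarrow> c' \<le> c"
    using GreatestI_nat[of Q 0 "card V"] Greatest_le_nat[of Q _ "card V"] by blast
  then obtain S2 R where S2: "S2 \<subseteq> S1" "\<not> countable S2" "\<And>D. D \<in> S2 \<Longrightarrow> initial_segment W R D" "card R = c"
    unfolding Q_def by blast
  have RD: "R \<subseteq> D" if "D \<in> S2" for D using S2(3)[OF that] by (auto simp: initial_segment_def)
  \<comment> \<open>If one member had an empty tail, all members, being of the same size, would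
    equal \<open>R\<close>.\<close>
  have ne: "D - R \<noteq> {}" if D: "D \<in> S2" for D
  proof
    assume "D - R = {}"
    then have "D = R" using RD[OF D] by blast
    then have "D' = R" if "D' \<in> S2" for D'
      using card_S1 S2(1) D that RD[OF that] S1(6) by (metis card_subset_eq subsetD)
    then have "S2 \<subseteq> {R}" by blast
    then show False using S2(2) by (meson countable_insert countable_empty countable_subset)
  qed
  have "\<exists>low. \<forall>D\<in>S2. low D \<in> D - R \<and> (\<forall>x\<in>D - R. low D \<sqsubseteq> x)"
  proof -
    have "\<exists>y. y \<in> D - R \<and> (\<forall>x\<in>D - R. y \<sqsubseteq> x)" if "D \<in> S2" for D
    proof -
      have "D - R \<subseteq> Field W" using S1(1) S2(1) that S(1) by blast
      then show ?thesis using ex_min[OF ne[OF that]] by blast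
    qed
    then show ?thesis by metis
  qed
  then obtain low where low: "\<And>D. D \<in> S2 \<Longrightarrow> low D \<in> D - R \<and> (\<forall>x\<in>D - R. low D \<sqsubseteq> x)"
    by blast
  \<comment> \<open>Uncountably many members with the same first tail element \<open>x\<close> would
    share the longer initial segment \<open>insert x R\<close>, against the maximality of
    \<open>c\<close>.\<close>
  have fiber: "countable {D \<in> S2. low D = x}" for x
  proof (rule ccontr)
    assume unc': "\<not> countable {D \<in> S2. low D = x}"
    then obtain D0 where D0: "D0 \<in> S2" "low D0 = x" by (metis (mono_tags, lifting) countable_empty empty_Collect_eq)
    have "initial_segment W (insert x R) D" if "D \<in> S2" "low D = x" for D
      unfolding initial_segment_def
    proof (intro conjI ballI impI)
      show "insert x R \<subseteq> D" using RD[OF that(1)] low[OF that(1)] that(2) by blast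
      fix u y assume u: "u \<in> insert x R" "y \<in> D" "y \<sqsubset> u"
      show "y \<in> insert x R"
      proof (rule ccontr)
        assume y: "y \<notin> insert x R"
        then have "x \<sqsubseteq> y" using low[OF that(1)] that(2) u by blast
        then have "u \<noteq> x" using u(3) le_lt_trans lt_irrefl by blast
        then show False
          using S2(3)[OF that(1)] u y unfolding initial_segment_def by blast
      qed
    qed
    moreover have "finite R" using RD[OF D0(1)] S1(6) S2(1) D0(1) finite_subset by blast
    then have "card (insert x R) = Suc c" using low[OF D0(1)] D0(2) S2(4) by simp
    ultimately have "Q (Suc c)"
      unfolding Q_def using S2(1) unc' by (intro exI[of _ "{D \<in> S2. low D = x}"] exI[of _ "insert x R"]) auto
    then show False using c(2) by fastforce
  qed
  have "\<forall>\<mu>. countable {D \<in> S2. low D \<sqsubseteq> \<mu>}"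
  proof
    fix \<mu>
    have "{D \<in> S2. low D \<sqsubseteq> \<mu>} = (\<Union>x\<in>{x. x \<sqsubseteq> \<mu>}. {D \<in> S2. low D = x})" by auto
    moreover have "countable (\<Union>x\<in>{x. x \<sqsubseteq> \<mu>}. {D \<in> S2. low D = x})"
      by (rule countable_UN[OF countable_le fiber])
    ultimately show "countable {D \<in> S2. low D \<sqsubseteq> \<mu>}" by simp
  qed
  moreover have "J \<le> k"
  proof -
    obtain D where "D \<in> S1" using unc unfolding S1_def by (metis countable_empty ex_in_conv)
    then show ?thesis using S1(5) by blast
  qed
  moreover have "S2 \<subseteq> S" using S2(1) S1(1) by blast
  moreover have "\<forall>D\<in>S2. top D \<in> D \<and> D \<subseteq> cl (top D) k \<and> (\<lambda>x. f x k) ` D = V"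
    using S1(2-4) S2(1) by (simp add: subset_iff)
  moreover have "\<forall>D\<in>S2. initial_segment W R D"
    "\<forall>D\<in>S2. low D \<in> D - R \<and> (\<forall>x\<in>D - R. low D \<sqsubseteq> x)"
    using S2(3) low by blast+
  ultimately show ?thesis
    using S2(2)
    by - (rule exI[of _ S2], rule exI[of _ k], rule exI[of _ V], rule exI[of _ R],
      rule exI[of _ top], rule exI[of _ low], intro conjI)
qed

lemma Delta_scheme:
  assumes "x \<in> Field W" "y \<in> Field W" "\<And>j. j \<le> l \<Longrightarrow> f x j = f y j" "f x (Suc l) \<noteq> f y (Suc l)"
  shows "Delta W (Field W) m scheme x y = enat (Suc l)"
proof -
  have "(LEAST k. f x k \<noteq> f y k) = Suc l"
    using assms(3,4) by (intro Least_equality) (auto simp: not_less_eq_eq[symmetric])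
  then show ?thesis
    using assms(4) by (auto simp: Delta_def norm_scheme assms(1,2))
qed

text \<open>One late member \<open>D\<close> of the thinned family only determines the level and the
  paths \<open>g\<close> and \<open>h\<close>. The captured system is chosen afterwards: for each
  block \<open>i\<close> a member whose top has position \<open>g l + i * M\<close> at level
  \<open>Suc l\<close> and whose tail lies after the previous top.\<close>

lemma fully_Delta_capturing_scheme:
  assumes surj: "\<And>T. \<exists>e\<in>Field W. E e = T"
  shows "fully_Delta_capturing W m n r scheme"
  unfolding fully_Delta_capturing_def infinite_nat_iff_unbounded
proof (intro allI impI)
  fix S J assume S: "S \<subseteq> {A. finite A \<and> A \<noteq> {} \<and> A \<subseteq> Field W} \<and> \<not> countable S"
  obtain S' k V R top low where S': "S' \<subseteq> S" "\<not> countable S'" "J \<le> k"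
    and top': "\<forall>D\<in>S'. top D \<in> D \<and> D \<subseteq> cl (top D) k \<and> (\<lambda>x. f x k) ` D = V"
    and init': "\<forall>D\<in>S'. initial_segment W R D"
    and low': "\<forall>D\<in>S'. low D \<in> D - R \<and> (\<forall>x\<in>D - R. low D \<sqsubseteq> x)"
    and tails': "\<forall>\<mu>. countable {D \<in> S'. low D \<sqsubseteq> \<mu>}"
    using thin_out[OF S[THEN conjunct1] S[THEN conjunct2], of J] by (elim exE conjE) (rule that)
  note top = bspec[OF top'] and init = bspec[OF init'] and low = bspec[OF low'] and tails = spec[OF tails']
  have D_fin: "finite D" and D_Field: "D \<subseteq> Field W" if "D \<in> S'" for D
    using that S'(1) S by auto
  have RD: "R \<subseteq> D" if "D \<in> S'" for D using init[OF that] by (auto simp: initial_segment_def)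
  define T where "T = {(j, v). \<not> countable {D \<in> S'. f (top D) j = v}}"
  obtain e where e: "e \<in> Field W" "E e = T" using surj by blast
  \<comment> \<open>Each of the countably many points outside \<open>T\<close> is visited by the
    tops of only countably many members.\<close>
  have bad: "countable {D \<in> S'. \<exists>j. (j, f (top D) j) \<notin> T}"
  proof -
    have "countable (\<Union>(j, v)\<in>-T. {D \<in> S'. f (top D) j = v})"
      by (intro countable_UN) (auto simp: T_def)
    moreover have "{D \<in> S'. \<exists>j. (j, f (top D) j) \<notin> T} \<subseteq> (\<Union>(j, v)\<in>-T. {D \<in> S'. f (top D) j = v})"
      by auto
    ultimately show ?thesis using countable_subset by blast
  qed
  obtain D0 where D0: "D0 \<in> S'" using S'(2) by (metis countable_empty ex_in_conv)
  have R_fin: "finite R" using RD[OF D0] D_fin[OF D0] finite_subset by blast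
  \<comment> \<open>The largest element of the root; for an empty root any ordinal serves, here
    \<open>e\<close>.\<close>
  obtain \<beta> where \<beta>: "\<beta> \<in> Field W" "\<And>x. x \<in> R \<Longrightarrow> x \<sqsubseteq> \<beta> \<and> \<beta> \<in> R"
  proof (cases "R = {}")
    case False
    have "R \<subseteq> Field W" using RD[OF D0] D_Field[OF D0] by blast
    then show ?thesis using ex_max[OF R_fin False] that by blast
  qed (use e that in blast)
  obtain \<mu> where \<mu>: "e \<sqsubseteq> \<mu>" "\<beta> \<sqsubseteq> \<mu>"
    using le_total[OF e(1) \<beta>(1)] le_refl e(1) \<beta>(1) lt_imp_le by blast
  then obtain \<kappa> where \<kappa>: "limit \<kappa>" "\<mu> \<sqsubset> \<kappa>" using ex_limit le_Field by metis
  have "countable ({D \<in> S'. \<exists>j. (j, f (top D) j) \<notin> T} \<union> {D \<in> S'. low D \<sqsubseteq> \<kappa>})"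
    using bad tails by simp
  then have "\<not> S' \<subseteq> {D \<in> S'. \<exists>j. (j, f (top D) j) \<notin> T} \<union> {D \<in> S'. low D \<sqsubseteq> \<kappa>}"
    using S'(2) countable_subset by blast
  \<comment> \<open>The top of this member never leaves \<open>T\<close> and its tail starts after
    \<open>\<kappa>\<close>, so genericity for \<open>e\<close> is available along the whole
    descent.\<close>
  then obtain D where D: "D \<in> S'" "\<And>j. (j, f (top D) j) \<in> T" "\<not> low D \<sqsubseteq> \<kappa>"
    by auto
  have lowD: "low D \<in> cl (top D) k" using low[OF D(1)] top[OF D(1)] by blast
  have "\<kappa> \<sqsubseteq> low D"
    using le_total[of "low D" \<kappa>] D(3) cl_Field[OF lowD] \<kappa> lt_Field lt_imp_le by blast
  then have "\<exists>l g h. k \<le> l \<and> g k = f (top D) k \<and> h k = f (low D) k \<and>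
    (\<forall>j. k \<le> j \<and> j < l \<longrightarrow> lstep j (g j) (g (Suc j)) \<and>
       (if h j < r (Suc j) then h (Suc j) = h j else h (Suc j) + g j = g (Suc j) + h j)) \<and>
    r (Suc l) \<le> g l \<and> r (Suc l) \<le> h l \<and> f \<beta> l < r (Suc l) \<and>
    (\<forall>i<n (Suc l). (Suc l, g l + 0 + i * (m l - r (Suc l))) \<in> E e)"
    using lowD D(2) e(2) \<mu> \<kappa> le_lt_trans
    by (intro capture_path[of \<kappa> e \<beta> "low D" "top D" k 0 0]) (auto simp: cl_def)
  then obtain l g h where l: "k \<le> l" "g k = f (top D) k" "h k = f (low D) k"
    and g_step: "\<And>j. k \<le> j \<Longrightarrow> j < l \<Longrightarrow> lstep j (g j) (g (Suc j))"
    and h_step: "\<And>j. k \<le> j \<Longrightarrow> j < l \<Longrightarrow>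
       (if h j < r (Suc j) then h (Suc j) = h j else h (Suc j) + g j = g (Suc j) + h j)"
    and r_le: "r (Suc l) \<le> g l" "r (Suc l) \<le> h l" and r_gt: "f \<beta> l < r (Suc l)"
    and split: "\<And>i. i < n (Suc l) \<Longrightarrow> (Suc l, g l + i * (m l - r (Suc l))) \<in> T"
    unfolding e(2) by auto
  define M where "M = m l - r (Suc l)"
  define N where "N = n (Suc l)"
  have N: "N \<ge> 2" using n_ge2 by (simp add: N_def)
  have M: "M > 0" using r_less_m[of l] by (simp add: M_def)
  have gk: "g k < m k" using l(2) f_less by simp
  \<comment> \<open>By the choice of \<open>T\<close> uncountably many members qualify, and only
    countably many have a tail starting at or before \<open>\<mu>'\<close>.\<close>
  have ex_next: "\<exists>D'\<in>S'. f (top D') (Suc l) = g l + i * M \<and> \<mu>' \<sqsubset> low D'" if "i < N" "\<mu>' \<in> Field W" for i \<mu>'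
  proof -
    have "\<not> countable {D \<in> S'. f (top D) (Suc l) = g l + i * M}"
      using split[of i] that by (simp add: T_def M_def N_def)
    then obtain D' where D': "D' \<in> S'" "f (top D') (Suc l) = g l + i * M" "\<not> low D' \<sqsubseteq> \<mu>'"
      using tails[of \<mu>'] countable_subset[of "{D \<in> S'. f (top D) (Suc l) = g l + i * M}" "{D \<in> S'. low D \<sqsubseteq> \<mu>'}"]
      by blast
    moreover have "low D' \<in> Field W" using low[OF D'(1)] D_Field[OF D'(1)] by blast
    ultimately show ?thesis using le_total[of "low D'" \<mu>'] that(2) by blast
  qed
  have "\<exists>Ds. \<forall>i. (Ds i \<in> S' \<and> (i < N \<longrightarrow> f (top (Ds i)) (Suc l) = g l + i * M)) \<and>
      (Suc i < N \<longrightarrow> top (Ds i) \<sqsubset> low (Ds (Suc i)))"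
  proof (rule dependent_nat_choice)
    show "\<exists>D. D \<in> S' \<and> (0 < N \<longrightarrow> f (top D) (Suc l) = g l + 0 * M)"
      using ex_next[of 0 e] e(1) N by auto
    fix D i assume "D \<in> S' \<and> (i < N \<longrightarrow> f (top D) (Suc l) = g l + i * M)"
    then have "D \<in> S'" "top D \<in> Field W" using top D_Field by blast+
    then show "\<exists>D'. (D' \<in> S' \<and> (Suc i < N \<longrightarrow> f (top D') (Suc l) = g l + Suc i * M)) \<and>
        (Suc i < N \<longrightarrow> top D \<sqsubset> low D')"
      using ex_next[of "Suc i" "top D"] by (cases "Suc i < N") blast+
  qed
  then obtain Ds where Ds: "\<And>i. Ds i \<in> S'" "\<And>i. i < N \<Longrightarrow> f (top (Ds i)) (Suc l) = g l + i * M"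
    and Ds_chain: "\<And>i. Suc i < N \<Longrightarrow> top (Ds i) \<sqsubset> low (Ds (Suc i))"
    by blast
  have Ds_below: "below k (f x) (f (top (Ds i)))" "x \<sqsubseteq> top (Ds i)" "x \<in> Field W" "x \<in> cl (top (Ds i)) k"
    if "x \<in> Ds i" for x i
    using that top[OF Ds(1)[of i]] D_Field[OF Ds(1)[of i]] by (auto simp: cl_def)
  \<comment> \<open>The position at level \<open>Suc l\<close> comes from \<open>g l\<close>, and
    below that the path of the top is forced down to level \<open>k\<close>.\<close>
  have top_g: "f (top (Ds i)) j = g j" if "i < N" "k \<le> j" "j \<le> l" for i j
  proof (rule path_unique_down[OF g_step gk f_branch _ that(2,3)])
    have "lstep l (g l) (g l + i * M)"
      using r_le(1) that(1) by (auto simp: lstep_def M_def N_def)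
    then show "f (top (Ds i)) l = g l"
      using lstep_inj[of l "f (top (Ds i)) l" "g l + i * M" "g l"] f_lstep[of l "top (Ds i)"] Ds(2)[OF that(1)]
        f_less[of "top (Ds i)" l] path_less[OF g_step gk l(1)] by simp
  qed
  \<comment> \<open>All members have the same label set \<open>V\<close>. An element of
    \<open>D1\<close> with the label of \<open>low D2\<close> is not in \<open>R\<close>, where it
    would have to be \<open>low D2\<close> itself; hence it is not before
    \<open>low D1\<close>.\<close>
  have low_le: "f (low D1) k \<le> f (low D2) k" if D12: "D1 \<in> S'" "D2 \<in> S'" for D1 D2
  proof -
    have "f (low D2) k \<in> (\<lambda>x. f x k) ` D1"
      using low[OF D12(2)] top[OF D12(1)] top[OF D12(2)] by blast
    then obtain x where x: "x \<in> D1" "f x k = f (low D2) k" by auto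
    have "x \<notin> R"
    proof
      assume "x \<in> R"
      then have "x \<in> D2" using RD[OF D12(2)] by blast
      then have "x = low D2"
        using x(2) low[OF D12(2)] top[OF D12(2)] cl_inj by blast
      then show False using \<open>x \<in> R\<close> low[OF D12(2)] by blast
    qed
    then have "low D1 \<sqsubseteq> x" using low[OF D12(1)] x(1) by blast
    moreover have "low D1 \<in> cl (top D1) k" "x \<in> cl (top D1) k"
      using low[OF D12(1)] top[OF D12(1)] x(1) by blast+
    ultimately have "\<not> f x k < f (low D1) k"
      using cl_lt_iff le_lt_trans lt_irrefl by blast
    then show ?thesis using x(2) by simp
  qed
  \<comment> \<open>Since the top follows \<open>g\<close>, the actual path of
    \<open>low (Ds i)\<close> obeys the recursion satisfied by \<open>h\<close>.\<close>
  have low_h: "f (low (Ds i)) j = h j" if "i < N" "k \<le> j" "j \<le> l" for i j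
    using that(2,3)
  proof (induction rule: dec_induct)
    case base
    then show ?case
      using low_le[OF Ds(1) D(1), of i] low_le[OF D(1) Ds(1), of i] l(3) by simp
  next
    case (step j)
    have lowin: "low (Ds i) \<in> Ds i" using low[OF Ds(1)] by blast
    have "f (low (Ds i)) (Suc j) = h (Suc j)"
    proof (cases "h j < r (Suc j)")
      case True
      then show ?thesis
        using step h_step[of j] lstep_root[OF f_lstep[of j "low (Ds i)"]] by simp
    next
      case False
      then show ?thesis
        using step h_step[of j] below_shift[OF Ds_below(1)[OF lowin], of j] top_g[of i j] top_g[of i "Suc j"] that(1)
        by simp
    qed
    then show ?case .
  qed
  \<comment> \<open>The first tail element has position \<open>h l\<close>, already outside the
    root, and the other tail elements lie above it.\<close>
  have tail_ge: "r (Suc l) \<le> f x l" if "i < N" "x \<in> Ds i - R" for i x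
  proof -
    have lowin: "low (Ds i) \<in> Ds i" "low (Ds i) \<sqsubseteq> x" using low[OF Ds(1)] that(2) by blast+
    have "below k (f (low (Ds i))) (f x)"
      using fam_below_cut[OF fam_all _ _ lowin(2) Ds_below(1)[OF lowin(1)] Ds_below(1)[of x i]]
        Ds_below(3) that(2) top[OF Ds(1)] by blast
    then show ?thesis
      using below_le[of k _ "f x" l] l(1) low_h[OF that(1), of l] r_le(2) by fastforce
  qed
  have tail_shift: "f x (Suc l) = f x l + i * M" if "i < N" "x \<in> Ds i - R" for i x
    using below_shift[OF Ds_below(1)[of x i] l(1)] tail_ge[OF that] that Ds(2)[OF that(1)]
      top_g[OF that(1) l(1)] by simp
  have root_less: "f x (Suc l) < r (Suc l)" if "x \<in> R" for x
  proof -
    have "x \<in> Ds 0" "\<beta> \<in> Ds 0" "x \<sqsubseteq> \<beta>" using RD[OF Ds(1)] \<beta>(2)[OF that] that by blast+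
    then have "below k (f x) (f \<beta>)"
      using fam_below_cut[OF fam_all _ _ \<open>x \<sqsubseteq> \<beta>\<close> Ds_below(1)[of x 0] Ds_below(1)[of \<beta> 0]]
        Ds_below(3) top[OF Ds(1)] by blast
    then have "f x l < r (Suc l)" using below_le[of k "f x" "f \<beta>" l] l(1) r_gt by simp
    then show ?thesis using lstep_root[OF f_lstep[of l x]] by simp
  qed
  have order: "top (Ds i) \<sqsubset> low (Ds j)" if "i < j" "j < N" for i j
    using that
  proof (induction j)
    case (Suc j)
    show ?case
    proof (cases "i = j")
      case True
      then show ?thesis using Ds_chain Suc by simp
    next
      case False
      then have "top (Ds i) \<sqsubset> low (Ds j)" using Suc by simp
      moreover have "low (Ds j) \<sqsubseteq> top (Ds j)" using low[OF Ds(1)] Ds_below(2) by blast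
      ultimately show ?thesis using Ds_chain[of j] Suc lt_le_trans lt_trans by blast
    qed
  qed simp
  have tails_lt: "x \<sqsubset> y" if "i < j" "j < N" "x \<in> Ds i" "y \<in> Ds j - R" for i j x y
  proof -
    have "low (Ds j) \<sqsubseteq> y" using low[OF Ds(1)] that(4) by blast
    then show ?thesis
      using order[OF that(1,2)] Ds_below(2)[OF that(3)] le_lt_trans lt_le_trans by blast
  qed
  have disj: "Ds i \<inter> Ds j = R" if "i < j" "j < N" for i j
    using tails_lt[OF that] RD[OF Ds(1)] lt_irrefl by blast
  have inter: "Ds i \<inter> Ds j = R" if "i < N" "j < N" "i \<noteq> j" for i j
    using disj[of i j] disj[of j i] that by (metis Int_commute linorder_neqE_nat)
  have card_D: "card (Ds i) = card V" for i
  proof -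
    have "inj_on (\<lambda>x. f x k) (Ds i)" using top[OF Ds(1)[of i]] inj_on_cl by blast
    then show ?thesis using top[OF Ds(1)[of i]] card_image by metis
  qed
  have rtt: "rtt_system W Ds N (card V) R"
    unfolding rtt_system_def
  proof (intro conjI allI impI)
    fix i assume "i < N"
    show "finite (Ds i)" using D_fin Ds(1) by blast
    show "card (Ds i) = card V" by (rule card_D)
    show "set_less W R (Ds i - R)"
      unfolding set_less_def
    proof (intro ballI)
      fix x y assume xy: "x \<in> R" "y \<in> Ds i - R"
      have "x \<in> Field W" "y \<in> Field W" using xy RD[OF Ds(1)] D_Field[OF Ds(1)] by blast+
      moreover have "\<not> y \<sqsubset> x" using init[OF Ds(1)[of i]] xy unfolding initial_segment_def by blast
      ultimately show "x \<sqsubset> y" using le_total[of x y] le_iff[of y x] xy by blast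
    qed
  next
    fix i assume "Suc i < N"
    then show "set_less W (Ds i - R) (Ds (Suc i) - R)"
      using tails_lt[of i "Suc i"] by (auto simp: set_less_def)
  qed (use N inter in auto)
  have in_R: "enum W (Ds i) a \<in> Ds i" "a < card R \<longleftrightarrow> enum W (Ds i) a \<in> R" if "a < card V" for i a
  proof -
    define x where "x = enum W (Ds i) a"
    have x: "x \<in> Ds i" "card {y \<in> Ds i. y \<sqsubset> x} = a"
      using enum_rank[OF D_fin[OF Ds(1)] D_Field[OF Ds(1)], of a i] card_D that by (auto simp: x_def)
    then show "enum W (Ds i) a \<in> Ds i" by (simp add: x_def)
    have initR: "\<forall>x\<in>R. \<forall>y\<in>Ds i. y \<sqsubset> x \<longrightarrow> y \<in> R"
      using init[OF Ds(1)[of i]] by (simp add: initial_segment_def)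
    have "a < card R" if "x \<in> R"
    proof -
      have "{y \<in> Ds i. y \<sqsubset> x} \<subseteq> R - {x}" using that initR by auto
      then have "a \<le> card (R - {x})" using x(2) R_fin by (metis card_mono finite_Diff)
      moreover have "card (R - {x}) < card R" using that R_fin by (rule card_Diff1_less[rotated])
      ultimately show ?thesis by simp
    qed
    moreover have "card R \<le> a" if "x \<notin> R"
    proof -
      have "y \<sqsubset> x" if "y \<in> R" for y
      proof -
        have "y \<in> Ds i" using that RD[OF Ds(1)] by blast
        then show ?thesis
          using le_total[of y x] le_iff[of x y] Ds_below(3) x(1) initR that \<open>x \<notin> R\<close> by blast
      qed
      then have "R \<subseteq> {y \<in> Ds i. y \<sqsubset> x}" using RD[OF Ds(1)] by blast
      then show ?thesis using x(2) D_fin[OF Ds(1)] card_mono by (metis (no_types, lifting) finite_Collect_conjI mem_Collect_eq finite_subset subsetI)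
    qed
    ultimately show "a < card R \<longleftrightarrow> enum W (Ds i) a \<in> R" unfolding x_def by (meson not_le)
  qed
  have "captured W m n r scheme (Delta W (Field W) m scheme) Ds N (Suc l)"
    unfolding captured_def
  proof (intro conjI exI allI impI)
    show "rtt_system W Ds N (card V) R" by (rule rtt)
    show "N \<le> n (Suc l)" by (simp add: N_def)
  next
    fix i a assume ia: "i < N" "a < card V"
    have F: "enum W (Ds i) a \<in> Field W" using in_R(1)[OF ia(2)] Ds_below(3) by blast
    show "Xi W m n r scheme (enum W (Ds i) a) (Suc l) = (if a < card R then - 1 else int i)"
    proof (cases "a < card R")
      case True
      then show ?thesis using Xi_scheme(1)[OF F] root_less in_R(2)[OF ia(2)] by simp
    next
      case False
      then have "enum W (Ds i) a \<in> Ds i - R" using in_R[OF ia(2)] by blast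
      then show ?thesis
        using Xi_scheme(2)[OF F tail_ge, of i] tail_shift[of i] ia(1) False by (simp add: M_def)
    qed
  next
    fix i j a assume ija: "i < j \<and> j < N \<and> card R \<le> a \<and> a < card V"
    define x where "x = enum W (Ds i) a"
    define y where "y = enum W (Ds j) a"
    have x: "x \<in> Ds i - R" and y: "y \<in> Ds j - R"
      using in_R[of a i] in_R[of a j] ija by (auto simp: x_def y_def)
    have lab: "f x k = f y k"
      unfolding x_def y_def
      by (rule same_rank_same_label[of _ "top (Ds i)" _ V _ "top (Ds j)"])
        (use top Ds(1) D_fin ija in blast)+
    \<comment> \<open>Equal labels at \<open>k\<close> and equal paths of the tops force equal paths
      up to \<open>l\<close>; the different blocks \<open>i\<close> and \<open>j\<close> then
      separate the two at \<open>Suc l\<close>.\<close>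
    have up: "f x j' = f y j'" if "k \<le> j'" "j' \<le> l" for j'
    proof (rule below_trace_unique[OF f_branch f_branch _ _ lab _ that])
      show "below k (f x) (f (top (Ds i)))" "below k (f y) (f (top (Ds j)))"
        using Ds_below(1) x y by blast+
      show "f (top (Ds i)) j'' = f (top (Ds j)) j''" if "k \<le> j''" "j'' \<le> l" for j''
        using top_g[of i j''] top_g[of j j''] that ija by simp
    qed
    have eq: "f x j' = f y j'" if "j' \<le> l" for j'
      using up that branch_eq_below[OF f_branch f_branch lab, of j'] by (cases "k \<le> j'") auto
    have "f x (Suc l) \<noteq> f y (Suc l)"
      using tail_shift[of i x] tail_shift[of j y] x y ija eq[of l] M by simp
    then show "Delta W (Field W) m scheme (enum W (Ds i) a) (enum W (Ds j) a) = enat (Suc l)"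
      using Delta_scheme[of x y l] eq Ds_below(3)[of x i] Ds_below(3)[of y j] x y
      unfolding x_def y_def by blast
  qed simp
  moreover have "inj_on Ds {..<N}"
  proof (rule inj_onI)
    fix i j assume "i \<in> {..<N}" "j \<in> {..<N}" "Ds i = Ds j"
    then show "i = j" using inter[of i j] low[OF Ds(1)[of i]] by auto
  qed
  \<comment> \<open>The thinning was done with a closure level \<open>k\<close> at least
    \<open>J\<close>, so captures occur at unboundedly many levels.\<close>
  moreover have "Suc l > J" using l(1) S'(3) by simp
  ultimately show "\<exists>l>J. l \<in> {l. \<exists>D. (\<forall>i<n l. D i \<in> S) \<and> inj_on D {..<n l} \<and>
      fully_captured W m n r scheme (Delta W (Field W) m scheme) D l}"
    using Ds(1) S'(1) unfolding fully_captured_def N_def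
    by (intro exI[of _ "Suc l"] conjI CollectI exI[of _ Ds]) auto
qed

end

theorem mainTheorem8:
  fixes W :: "'a rel"
  assumes "CH"
    and "omega1_order W"
  shows "\<forall>m n r. good_type m n r \<longrightarrow>
           (\<exists>\<F>. construction_scheme W (Field W) m n r \<F> \<and> fully_Delta_capturing W m n r \<F>)"
proof (intro allI impI)
  fix m n r :: "nat \<Rightarrow> nat"
  assume good: "good_type m n r"
  have "\<not> countable (Field W)" using assms(2) by (simp add: omega1_order_def)
  then obtain E :: "'a \<Rightarrow> (nat \<times> nat) set" where E: "\<And>T. \<exists>e\<in>Field W. E e = T"
    using CH_enumeration[OF assms(1)] by blast
  interpret scheme_order m n r W E
    by unfold_locales (use good assms in auto)
  obtain f where f: "\<forall>a. node_ok f a (f a)" using ex_nodes by blast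
  interpret scheme_tower m n r W E f
    by unfold_locales (use f in blast)
  show "\<exists>\<F>. construction_scheme W (Field W) m n r \<F> \<and> fully_Delta_capturing W m n r \<F>"
    using construction_scheme_scheme fully_Delta_capturing_scheme[OF E] by blast
qed

end
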